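(* Assume $n\ge3$. (1) Let $V$ be a real vector space of dimension $n$ with a non-degenerate symmetric inner product $h$, and let $A\in\mathfrak{W}(V)$ be a Weyl generalized curvature tensor. Then the conjugate tensor $A^*$ satisfies the Bianchi identity $A^*(x,y,z,w)+A^*(y,z,x,w)+A^*(z,x,y,w)=0$ for all $x,y,z,w\in V$ if and only if $A$ is an algebraic curvature tensor, i.e. $A\in\mathfrak{A}(V)$. (2) Let $(N,g,\nabla)$ be a Weyl manifold of dimension $n$ with $H^1(N;\mathbb{R})=0$ (de Rham cohomology), and let $R$ be the $g$-associated curvature tensor of $\nabla$. Assume that the conjugate curvature tensor $R^*$ is (at every point of $N$) a generalized curvature tensor. Then there exists $f\in C^\infty(N)$ such that $\nabla$ is the Levi-Civita connection of the conformally equivalent metric $e^{2f}g$.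
   Context: Algebraic setting: for $A\in\otimes^4V^*$, let $\operatorname{Ric}(x,y):=\sum_{i,l}h^{il}A(e_i,x,y,e_l)$, where $\{e_i\}$ is any basis of $V$ and $(h^{il})$ is the inverse of the matrix $(h(e_i,e_l))$. Consider the following conditions, for all $x,y,z,w\in V$: (i) $A(x,y,z,w)+A(y,x,z,w)=0$; (ii) (Bianchi identity) $A(x,y,z,w)+A(y,z,x,w)+A(z,x,y,w)=0$; (iii) $A(x,y,z,w)+A(x,y,w,z)=\frac2n\{\operatorname{Ric}(y,x)-\operatorname{Ric}(x,y)\}h(z,w)$; (iv) $A(x,y,z,w)+A(x,y,w,z)=0$. Generalized curvature tensors $\mathfrak{R}(V)$: those $A$ satisfying (i), (ii). Weyl generalized curvature tensors $\mathfrak{W}(V)$: those satisfying (i), (ii), (iii). Algebraic curvature tensors $\mathfrak{A}(V)$: those satisfying (i), (ii), (iv). Conjugate tensor: $A^*(x,y,w,z):=-A(x,y,z,w)$, and similarly $R^*(x,y,w,z):=-R(x,y,z,w)$ pointwise on a manifold. Weyl manifold: a triple $(N,g,\nabla)$ where $g$ is a pseudo-Riemannian metric on a smooth manifold $N$ and $\nabla$ is a torsion free connection on $TN$ with $\nabla g=-2\phi\otimes g$ for some smooth $1$-form $\phi$ on $N$, i.e. $(\nabla_x g)(y,z)=-2\phi(x)g(y,z)$. Curvature: $\mathcal{R}(x,y)z:=(\nabla_x\nabla_y-\nabla_y\nabla_x-\nabla_{[x,y]})z$ and $R(x,y,z,w):=g(\mathcal{R}(x,y)z,w)$. *)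

theory Defs
  imports "HOL-Analysis.Analysis" "HOL-Library.Function_Algebras"
begin

section \<open>Algebraic curvature tensors\<close>

text \<open>A real vector space is represented by a subspace \<open>V\<close> of a type of class \<open>real_vector\<close>;
  forms and tensors on \<open>V\<close> are functions whose values outside of \<open>V\<close> are irrelevant.\<close>

definition linear_form_on :: "'v::real_vector set \<Rightarrow> ('v \<Rightarrow> real) \<Rightarrow> bool" where
  "linear_form_on V f \<longleftrightarrow>
     (\<forall>x\<in>V. \<forall>y\<in>V. f (x + y) = f x + f y) \<and> (\<forall>c. \<forall>x\<in>V. f (c *\<^sub>R x) = c * f x)"

definition bilinear_form_on :: "'v::real_vector set \<Rightarrow> ('v \<Rightarrow> 'v \<Rightarrow> real) \<Rightarrow> bool" where
  "bilinear_form_on V h \<longleftrightarrow>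
     (\<forall>x\<in>V. linear_form_on V (\<lambda>y. h x y)) \<and> (\<forall>y\<in>V. linear_form_on V (\<lambda>x. h x y))"

definition inner_product_on :: "'v::real_vector set \<Rightarrow> ('v \<Rightarrow> 'v \<Rightarrow> real) \<Rightarrow> bool" where
  "inner_product_on V h \<longleftrightarrow> bilinear_form_on V h \<and>
     (\<forall>x\<in>V. \<forall>y\<in>V. h x y = h y x) \<and> (\<forall>x\<in>V. (\<forall>y\<in>V. h x y = 0) \<longrightarrow> x = 0)"

type_synonym 'v tensor4 = "'v \<Rightarrow> 'v \<Rightarrow> 'v \<Rightarrow> 'v \<Rightarrow> real"

definition quadrilinear_on :: "'v::real_vector set \<Rightarrow> 'v tensor4 \<Rightarrow> bool" where
  "quadrilinear_on V A \<longleftrightarrow>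
     (\<forall>x\<in>V. \<forall>y\<in>V. \<forall>z\<in>V.
        linear_form_on V (\<lambda>u. A u x y z) \<and> linear_form_on V (\<lambda>u. A x u y z) \<and>
        linear_form_on V (\<lambda>u. A x y u z) \<and> linear_form_on V (\<lambda>u. A x y z u))"

definition basis_of :: "'v::real_vector set \<Rightarrow> 'v set \<Rightarrow> bool" where
  "basis_of V B \<longleftrightarrow> independent B \<and> span B = V"

definition is_inverse_gram :: "'v set \<Rightarrow> ('v \<Rightarrow> 'v \<Rightarrow> real) \<Rightarrow> ('v \<Rightarrow> 'v \<Rightarrow> real) \<Rightarrow> bool" where
  "is_inverse_gram B h H \<longleftrightarrow>
     (\<forall>i\<in>B. \<forall>j\<in>B. (\<Sum>l\<in>B. h i l * H l j) = (if i = j then 1 else 0)) \<and>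
     (\<forall>i\<in>B. \<forall>j\<in>B. (\<Sum>l\<in>B. H i l * h l j) = (if i = j then 1 else 0))"

definition inverse_gram :: "'v set \<Rightarrow> ('v \<Rightarrow> 'v \<Rightarrow> real) \<Rightarrow> 'v \<Rightarrow> 'v \<Rightarrow> real" where
  "inverse_gram B h = (SOME H. is_inverse_gram B h H)"

definition ricci_wrt :: "'v set \<Rightarrow> ('v \<Rightarrow> 'v \<Rightarrow> real) \<Rightarrow> 'v tensor4 \<Rightarrow> 'v \<Rightarrow> 'v \<Rightarrow> real" where
  "ricci_wrt B h A x y = (\<Sum>i\<in>B. \<Sum>l\<in>B. inverse_gram B h i l * A i x y l)"

text \<open>The choice of the basis is irrelevant, see \<open>ricci_eq_ricci_wrt\<close> below.\<close>

definition ricci :: "'v::real_vector set \<Rightarrow> ('v \<Rightarrow> 'v \<Rightarrow> real) \<Rightarrow> 'v tensor4 \<Rightarrow> 'v \<Rightarrow> 'v \<Rightarrow> real" where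
  "ricci V h A = ricci_wrt (SOME B. basis_of V B) h A"

definition bianchi_identity_on :: "'v set \<Rightarrow> 'v tensor4 \<Rightarrow> bool" where
  "bianchi_identity_on V A \<longleftrightarrow>
     (\<forall>x\<in>V. \<forall>y\<in>V. \<forall>z\<in>V. \<forall>w\<in>V. A x y z w + A y z x w + A z x y w = 0)"

definition generalized_curvature_tensors :: "'v::real_vector set \<Rightarrow> 'v tensor4 set" where
  "generalized_curvature_tensors V =
     {A. quadrilinear_on V A \<and>
         (\<forall>x\<in>V. \<forall>y\<in>V. \<forall>z\<in>V. \<forall>w\<in>V. A x y z w + A y x z w = 0) \<and>
         bianchi_identity_on V A}"

definition weyl_curvature_tensors ::
    "'v::real_vector set \<Rightarrow> ('v \<Rightarrow> 'v \<Rightarrow> real) \<Rightarrow> 'v tensor4 set" where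
  "weyl_curvature_tensors V h =
     {A \<in> generalized_curvature_tensors V.
        \<forall>x\<in>V. \<forall>y\<in>V. \<forall>z\<in>V. \<forall>w\<in>V.
          A x y z w + A x y w z = 2 / real (dim V) * (ricci V h A y x - ricci V h A x y) * h z w}"

definition algebraic_curvature_tensors :: "'v::real_vector set \<Rightarrow> 'v tensor4 set" where
  "algebraic_curvature_tensors V =
     {A \<in> generalized_curvature_tensors V.
        \<forall>x\<in>V. \<forall>y\<in>V. \<forall>z\<in>V. \<forall>w\<in>V. A x y z w + A x y w z = 0}"

definition conjugate_tensor :: "'v tensor4 \<Rightarrow> 'v tensor4" where
  "conjugate_tensor A = (\<lambda>x y w z. - A x y z w)"


subsection \<open>Independence of the Ricci tensor of the basis\<close>

lemma linear_form_on_sum: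
  assumes "subspace V" "linear_form_on V f" "finite S" "S \<subseteq> V"
  shows "f (\<Sum>b\<in>S. c b *\<^sub>R b) = (\<Sum>b\<in>S. c b * f b)"
  using assms(3,4)
proof (induction S rule: finite_induct)
  case empty
  have "f (0 *\<^sub>R 0) = 0 * f 0"
    using assms(1,2) subspace_0 unfolding linear_form_on_def by blast
  then show ?case by simp
next
  case (insert b S)
  then have "c b *\<^sub>R b \<in> V" "(\<Sum>b\<in>S. c b *\<^sub>R b) \<in> V" "b \<in> V"
    using assms(1) by (auto intro!: subspace_scale subspace_sum)
  then show ?case
    using insert assms(2) by (simp add: linear_form_on_def)
qed

lemma linear_form_on_expand:
  assumes "basis_of V B" "finite B" "linear_form_on V f" "x \<in> V"
  shows "f x = (\<Sum>b\<in>B. representation B x b * f b)"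
proof -
  have "subspace V" "B \<subseteq> V"
    using assms(1) unfolding basis_of_def by (auto intro: subspace_span span_base)
  moreover have "(\<Sum>b\<in>B. representation B x b *\<^sub>R b) = x"
    using assms unfolding basis_of_def by (intro real_vector.sum_representation_eq) auto
  ultimately show ?thesis
    using linear_form_on_sum[of V f B "representation B x"] assms by simp
qed

lemma representation_change:
  assumes "basis_of V B" "finite B" "basis_of V B'" "x \<in> V"
  shows "(\<Sum>k\<in>B. representation B x k * representation B' k c) = representation B' x c"
proof -
  have sub: "subspace V" using assms(1) unfolding basis_of_def by auto
  have "linear_form_on V (\<lambda>x. representation B' x c)"
    using assms(3) unfolding linear_form_on_def basis_of_def
    by (auto simp: real_vector.representation_add real_vector.representation_scale)
  from linear_form_on_expand[OF assms(1,2) this assms(4)] show ?thesis by simp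
qed

lemma inverse_gram_unique:
  assumes "finite B" "\<And>i j. i \<in> B \<Longrightarrow> j \<in> B \<Longrightarrow> (\<Sum>l\<in>B. h i l * K l j) = (if i = j then 1 else (0::real))"
    and "\<And>i j. i \<in> B \<Longrightarrow> j \<in> B \<Longrightarrow> (\<Sum>l\<in>B. H i l * h l j) = (if i = j then 1 else 0)"
    and "i \<in> B" "j \<in> B"
  shows "H i j = K i j"
proof -
  have "H i j = (\<Sum>l\<in>B. H i l * (\<Sum>k\<in>B. h l k * K k j))"
  proof -
    have "(\<Sum>l\<in>B. H i l * (\<Sum>k\<in>B. h l k * K k j)) = (\<Sum>l\<in>B. if l = j then H i l else 0)"
      using assms(5) by (intro sum.cong refl) (simp add: assms(2))
    then show ?thesis using assms(1,5) by (simp add: sum.delta)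
  qed
  also have "\<dots> = (\<Sum>k\<in>B. (\<Sum>l\<in>B. H i l * h l k) * K k j)"
    by (simp add: sum_distrib_left sum_distrib_right mult.assoc) (rule sum.swap)
  also have "\<dots> = K i j"
  proof -
    have "(\<Sum>k\<in>B. (\<Sum>l\<in>B. H i l * h l k) * K k j) = (\<Sum>k\<in>B. if i = k then K k j else 0)"
      using assms(4) by (intro sum.cong refl) (simp add: assms(3))
    then show ?thesis using assms(1,4) by (simp add: sum.delta)
  qed
  finally show ?thesis .
qed

lemma is_inverse_gram_inverse_gram:
  fixes V :: "'v::real_vector set"
  assumes B: "basis_of V B" "finite B" and h: "inner_product_on V h"
  shows "is_inverse_gram B h (inverse_gram B h)"
proof -
  have ind: "independent B" and sp: "span B = V" and BV: "B \<subseteq> V"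
    using B(1) unfolding basis_of_def by (auto intro: span_base)
  have sub: "subspace V" using sp by auto
  have lin: "linear_form_on V (\<lambda>y. h x y)" if "x \<in> V" for x
    using h that unfolding inner_product_on_def bilinear_form_on_def by auto
  have linl: "linear_form_on V (\<lambda>x. h x y)" if "y \<in> V" for y
    using h that unfolding inner_product_on_def bilinear_form_on_def by auto
  have sym: "h x y = h y x" if "x \<in> V" "y \<in> V" for x y
    using h that unfolding inner_product_on_def by auto
  define \<phi> where "\<phi> v = (\<Sum>i\<in>B. h i v *\<^sub>R i)" for v
  obtain f where f: "linear f" "\<And>b. b \<in> B \<Longrightarrow> f b = \<phi> b"
    using linear_independent_extend[OF ind] by blast
  have f\<phi>: "f v = \<phi> v" if "v \<in> V" for v
  proof -
    have v: "(\<Sum>b\<in>B. representation B v b *\<^sub>R b) = v"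
      using ind sp B(2) that by (intro real_vector.sum_representation_eq) auto
    have "f v = (\<Sum>b\<in>B. representation B v b *\<^sub>R \<phi> b)"
      using f by (subst v[symmetric]) (simp add: linear_sum linear_cmul)
    also have "\<dots> = (\<Sum>i\<in>B. (\<Sum>b\<in>B. representation B v b * h i b) *\<^sub>R i)"
      unfolding \<phi>_def scaleR_sum_left scaleR_sum_right by (subst sum.swap) simp
    also have "\<dots> = \<phi> v"
      unfolding \<phi>_def using BV
      by (intro sum.cong refl) (simp add: linear_form_on_expand[OF B lin that, symmetric] subset_iff)
    finally show ?thesis .
  qed
  have coeff: "c i = 0" if "(\<Sum>i\<in>B. c i *\<^sub>R i) = 0" "i \<in> B" for c :: "'v \<Rightarrow> real" and i
    using real_vector.dependent_finite[OF B(2)] ind that by blast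
  have inj: "inj_on f (span B)"
  proof (subst linear_inj_on_iff_eq_0[OF f(1) subspace_span], intro ballI impI)
    fix v assume v: "v \<in> span B" "f v = 0"
    then have vV: "v \<in> V" and "(\<Sum>i\<in>B. h i v *\<^sub>R i) = 0"
      using sp f\<phi>[of v] by (auto simp: \<phi>_def)
    then have "h i v = 0" if "i \<in> B" for i
      using coeff[of "\<lambda>i. h i v"] that by blast
    then have "h x v = 0" if "x \<in> V" for x
      by (subst linear_form_on_expand[OF B linl[OF vV] that]) simp
    then have "\<forall>y\<in>V. h v y = 0" using sym vV by auto
    then show "v = 0" using h vV unfolding inner_product_on_def by blast
  qed
  have fBV: "f ` B \<subseteq> V"
    using f(2) BV sub by (auto simp: \<phi>_def intro!: subspace_sum subspace_scale)
  have find: "independent (f ` B)"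
    by (rule linear_independent_injective_image[OF f(1) ind inj])
  have "inj_on f B" using inj span_superset by (rule inj_on_subset)
  then have cardf: "card (f ` B) = card B" by (rule card_image)
  have fsp: "b \<in> span (f ` B)" if "b \<in> V" for b
  proof (rule ccontr)
    assume nb: "b \<notin> span (f ` B)"
    then have "independent (insert b (f ` B))"
      using find by (rule independent_insertI)
    moreover have "insert b (f ` B) \<subseteq> span B" using fBV sp that by auto
    ultimately have "card (insert b (f ` B)) \<le> card B"
      using real_vector.independent_span_bound[OF B(2)] by blast
    moreover have "b \<notin> f ` B" using nb by (auto intro: span_base)
    ultimately show False using cardf B(2) by simp
  qed
  have "\<exists>d\<in>V. f d = j" if "j \<in> B" for j
    using fsp[of j] that BV linear_span_image[OF f(1), of B] sp by auto
  then obtain d where d: "\<And>j. j \<in> B \<Longrightarrow> d j \<in> V" "\<And>j. j \<in> B \<Longrightarrow> f (d j) = j"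
    by metis
  have hd: "h i (d j) = (if i = j then 1 else 0)" if "i \<in> B" "j \<in> B" for i j
  proof -
    have "(\<Sum>k\<in>B. (if k = j then 1 else 0 :: real) *\<^sub>R k) = j"
      using that B(2) by (simp add: if_distrib[of "\<lambda>x. x *\<^sub>R _"] sum.delta cong: if_cong)
    moreover have "(\<Sum>k\<in>B. h k (d j) *\<^sub>R k) = j"
      using d[OF that(2)] f\<phi>[of "d j"] by (simp add: \<phi>_def)
    ultimately have "(\<Sum>k\<in>B. (h k (d j) - (if k = j then 1 else 0)) *\<^sub>R k) = 0"
      by (simp add: scaleR_left_diff_distrib sum_subtractf)
    from coeff[OF this that(1)] show ?thesis by simp
  qed
  define H where "H l j = representation B (d j) l" for l j
  have right: "(\<Sum>l\<in>B. h i l * H l j) = (if i = j then 1 else 0)" if "i \<in> B" "j \<in> B" for i j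
  proof -
    have "h i (d j) = (\<Sum>l\<in>B. H l j * h i l)"
      unfolding H_def using that BV d(1) by (intro linear_form_on_expand[OF B lin]) auto
    then show ?thesis using hd[OF that] by (simp add: mult.commute)
  qed
  have left: "(\<Sum>l\<in>B. H l i * h l j) = (if i = j then 1 else 0)" if "i \<in> B" "j \<in> B" for i j
  proof -
    have "(\<Sum>l\<in>B. H l i * h l j) = (\<Sum>l\<in>B. h j l * H l i)"
      using sym that BV by (intro sum.cong refl) (auto simp: mult.commute subset_iff)
    then show ?thesis using right[OF that(2,1)] by auto
  qed
  have symH: "H j i = H i j" if "i \<in> B" "j \<in> B" for i j
    using inverse_gram_unique[OF B(2) right left that] by simp
  have "is_inverse_gram B h H"
    unfolding is_inverse_gram_def
  proof (intro conjI ballI)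
    fix i j assume ij: "i \<in> B" "j \<in> B"
    have "(\<Sum>l\<in>B. H i l * h l j) = (\<Sum>l\<in>B. H l i * h l j)"
      using symH ij by (intro sum.cong refl) simp
    then show "(\<Sum>l\<in>B. H i l * h l j) = (if i = j then 1 else 0)" using left[OF ij] by simp
  qed (use right in auto)
  then show ?thesis unfolding inverse_gram_def by (rule someI[where P = "is_inverse_gram B h"])
qed

lemma ricci_wrt_independent:
  assumes B: "basis_of V B" "finite B" and B': "basis_of V B'" "finite B'"
    and h: "inner_product_on V h" and A: "quadrilinear_on V A" and xy: "x \<in> V" "y \<in> V"
  shows "ricci_wrt B h A x y = ricci_wrt B' h A x y"
proof -
  have BV: "B \<subseteq> V" and BV': "B' \<subseteq> V"
    using B(1) B'(1) unfolding basis_of_def by (auto intro: span_base)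
  let ?H = "inverse_gram B h" and ?H' = "inverse_gram B' h"
  define a where "a i c = representation B' i c" for i c
  define b where "b c i = representation B c i" for c i
  note H = is_inverse_gram_inverse_gram[OF B h, unfolded is_inverse_gram_def]
  note H' = is_inverse_gram_inverse_gram[OF B' h, unfolded is_inverse_gram_def]
  have lin: "linear_form_on V (\<lambda>y. h x y)" "linear_form_on V (\<lambda>z. h z x)" if "x \<in> V" for x
    using h that unfolding inner_product_on_def bilinear_form_on_def by auto
  have Alin: "linear_form_on V (\<lambda>u. A u x y w)" "linear_form_on V (\<lambda>u. A w x y u)" if "w \<in> V" for w
    using A xy that unfolding quadrilinear_on_def by blast+
  define K where "K d c = (\<Sum>i\<in>B. \<Sum>l\<in>B. ?H i l * a i d * a l c)" for d c
  have K: "(\<Sum>d\<in>B'. h e d * K d c) = (if e = c then 1 else 0)" if ec: "e \<in> B'" "c \<in> B'" for e c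
  proof -
    have hei: "(\<Sum>d\<in>B'. a i d * h e d) = (\<Sum>k\<in>B. b e k * h k i)" if "i \<in> B" for i
      using linear_form_on_expand[OF B' lin(1), of e i] linear_form_on_expand[OF B lin(2), of i e]
        that ec BV BV' unfolding a_def b_def by (simp add: subset_iff)
    have "(\<Sum>d\<in>B'. h e d * K d c) = (\<Sum>d\<in>B'. \<Sum>i\<in>B. \<Sum>l\<in>B. h e d * (?H i l * a i d * a l c))"
      unfolding K_def by (simp add: sum_distrib_left)
    also have "\<dots> = (\<Sum>i\<in>B. \<Sum>d\<in>B'. \<Sum>l\<in>B. h e d * (?H i l * a i d * a l c))"
      by (rule sum.swap)
    also have "\<dots> = (\<Sum>i\<in>B. \<Sum>l\<in>B. \<Sum>d\<in>B'. h e d * (?H i l * a i d * a l c))"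
      by (rule sum.cong[OF refl]) (rule sum.swap)
    also have "\<dots> = (\<Sum>i\<in>B. \<Sum>l\<in>B. (\<Sum>d\<in>B'. a i d * h e d) * (?H i l * a l c))"
      by (simp add: sum_distrib_right sum_distrib_left mult_ac)
    also have "\<dots> = (\<Sum>i\<in>B. \<Sum>l\<in>B. \<Sum>k\<in>B. b e k * h k i * (?H i l * a l c))"
      by (intro sum.cong refl) (simp add: hei sum_distrib_right)
    also have "\<dots> = (\<Sum>l\<in>B. \<Sum>i\<in>B. \<Sum>k\<in>B. b e k * h k i * (?H i l * a l c))"
      by (rule sum.swap)
    also have "\<dots> = (\<Sum>l\<in>B. \<Sum>k\<in>B. \<Sum>i\<in>B. b e k * h k i * (?H i l * a l c))"
      by (rule sum.cong[OF refl]) (rule sum.swap)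
    also have "\<dots> = (\<Sum>l\<in>B. \<Sum>k\<in>B. b e k * a l c * (\<Sum>i\<in>B. h k i * ?H i l))"
      by (simp add: sum_distrib_right sum_distrib_left mult_ac)
    also have "\<dots> = (\<Sum>l\<in>B. \<Sum>k\<in>B. if k = l then b e k * a l c else 0)"
      using H by (intro sum.cong refl) auto
    also have "\<dots> = (\<Sum>l\<in>B. b e l * a l c)"
      using B(2) by (simp add: sum.delta)
    also have "\<dots> = representation B' e c"
      unfolding a_def b_def using ec BV' by (intro representation_change[OF B B'(1)]) auto
    also have "\<dots> = (if e = c then 1 else 0)"
      using B'(1) ec by (auto simp: basis_of_def real_vector.representation_basis)
    finally show ?thesis .
  qed
  have KH: "?H' d c = K d c" if "d \<in> B'" "c \<in> B'" for d c
    using H' by (intro inverse_gram_unique[OF B'(2) K _ that]) auto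
  have Ail: "A i x y l = (\<Sum>d\<in>B'. \<Sum>c\<in>B'. a i d * a l c * A d x y c)" if "i \<in> B" "l \<in> B" for i l
  proof -
    have "A i x y l = (\<Sum>d\<in>B'. a i d * A d x y l)"
      unfolding a_def using that BV by (intro linear_form_on_expand[OF B' Alin(1)]) auto
    also have "\<dots> = (\<Sum>d\<in>B'. a i d * (\<Sum>c\<in>B'. a l c * A d x y c))"
      using that BV BV' unfolding a_def
      by (intro sum.cong refl arg_cong2[where f = "(*)"] linear_form_on_expand[OF B' Alin(2)]) auto
    finally show ?thesis by (simp add: sum_distrib_left mult.assoc)
  qed
  have "ricci_wrt B h A x y
      = (\<Sum>i\<in>B. \<Sum>l\<in>B. \<Sum>d\<in>B'. \<Sum>c\<in>B'. ?H i l * a i d * a l c * A d x y c)"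
    unfolding ricci_wrt_def
    by (intro sum.cong refl) (simp add: Ail sum_distrib_left mult.assoc)
  also have "\<dots> = (\<Sum>i\<in>B. \<Sum>d\<in>B'. \<Sum>l\<in>B. \<Sum>c\<in>B'. ?H i l * a i d * a l c * A d x y c)"
    by (rule sum.cong[OF refl]) (rule sum.swap)
  also have "\<dots> = (\<Sum>d\<in>B'. \<Sum>i\<in>B. \<Sum>l\<in>B. \<Sum>c\<in>B'. ?H i l * a i d * a l c * A d x y c)"
    by (rule sum.swap)
  also have "\<dots> = (\<Sum>d\<in>B'. \<Sum>i\<in>B. \<Sum>c\<in>B'. \<Sum>l\<in>B. ?H i l * a i d * a l c * A d x y c)"
    by (rule sum.cong[OF refl], rule sum.cong[OF refl], rule sum.swap)
  also have "\<dots> = (\<Sum>d\<in>B'. \<Sum>c\<in>B'. \<Sum>i\<in>B. \<Sum>l\<in>B. ?H i l * a i d * a l c * A d x y c)"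
    by (rule sum.cong[OF refl], rule sum.swap)
  also have "\<dots> = ricci_wrt B' h A x y"
    unfolding ricci_wrt_def by (intro sum.cong refl) (simp add: KH K_def sum_distrib_right)
  finally show ?thesis .
qed

lemma ricci_eq_ricci_wrt:
  assumes B: "basis_of V B" "finite B"
    and "inner_product_on V h" "quadrilinear_on V A" "x \<in> V" "y \<in> V"
  shows "ricci V h A x y = ricci_wrt B h A x y"
proof -
  define B0 where "B0 = (SOME B. basis_of V B)"
  have B0: "basis_of V B0" unfolding B0_def using B(1) by (rule someI)
  then have "B0 \<subseteq> span B" "independent B0"
    using B(1) by (auto simp: basis_of_def intro: span_base)
  then have "finite B0" using real_vector.independent_span_bound[OF B(2)] by blast
  then show ?thesis
    unfolding ricci_def B0_def[symmetric] by (intro ricci_wrt_independent[OF B0 _ assms])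
qed


section \<open>Smooth manifolds\<close>

primrec Ck_on :: "nat \<Rightarrow> 'e::real_normed_vector set \<Rightarrow> ('e \<Rightarrow> 'f::real_normed_vector) \<Rightarrow> bool" where
  "Ck_on 0 S f \<longleftrightarrow> continuous_on S f"
| "Ck_on (Suc k) S f \<longleftrightarrow>
     (\<forall>x\<in>S. f differentiable (at x)) \<and> (\<forall>v. Ck_on k S (\<lambda>x. frechet_derivative f (at x) v))"

text \<open>Only used for open subsets of Euclidean spaces.\<close>

definition smooth_on :: "'e::real_normed_vector set \<Rightarrow> ('e \<Rightarrow> 'f::real_normed_vector) \<Rightarrow> bool" where
  "smooth_on S f \<longleftrightarrow> (\<forall>k. Ck_on k S f)"

text \<open>A chart is a pair of its domain and its coordinate map; the model space \<open>'e\<close> carries the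
  dimension. The underlying set of points is the \<open>topspace\<close> of the topology.\<close>

record ('a, 'e) atlas_space =
  topology_of :: "'a topology"
  atlas :: "('a set \<times> ('a \<Rightarrow> 'e)) set"

definition points :: "('a, 'e) atlas_space \<Rightarrow> 'a set" where
  "points M = topspace (topology_of M)"

definition smooth_manifold :: "('a, 'e::euclidean_space) atlas_space \<Rightarrow> bool" where
  "smooth_manifold M \<longleftrightarrow>
     Hausdorff_space (topology_of M) \<and> second_countable (topology_of M) \<and>
     (\<Union>(U, c)\<in>atlas M. U) = points M \<and>
     (\<forall>(U, c)\<in>atlas M. openin (topology_of M) U \<and> open (c ` U) \<and>
        homeomorphic_map (subtopology (topology_of M) U) (top_of_set (c ` U)) c) \<and>
     (\<forall>(U, c)\<in>atlas M. \<forall>(U', c')\<in>atlas M. smooth_on (c ` (U \<inter> U')) (c' \<circ> inv_into U c))"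

definition smooth_function :: "('a, 'e::euclidean_space) atlas_space \<Rightarrow> ('a \<Rightarrow> real) \<Rightarrow> bool" where
  "smooth_function M f \<longleftrightarrow> (\<forall>(U, c)\<in>atlas M. smooth_on (c ` U) (f \<circ> inv_into U c))"

text \<open>Tangent vectors are derivations of the algebra of smooth functions.\<close>

instantiation "fun" :: (type, scaleR) scaleR
begin
definition "c *\<^sub>R f = (\<lambda>x. c *\<^sub>R f x)"
instance ..
end

lemma scaleR_fun_apply [simp]: "(c *\<^sub>R f) x = c *\<^sub>R f x"
  by (simp add: scaleR_fun_def)

instance "fun" :: (type, real_vector) real_vector
  by standard (simp_all add: fun_eq_iff scaleR_add_right scaleR_add_left)

type_synonym 'a tangent_vector = "('a \<Rightarrow> real) \<Rightarrow> real"

definition tangent_space ::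
    "('a, 'e::euclidean_space) atlas_space \<Rightarrow> 'a \<Rightarrow> 'a tangent_vector set" where
  "tangent_space M p =
     {v. (\<forall>f f'. smooth_function M f \<longrightarrow> smooth_function M f' \<longrightarrow>
            v (\<lambda>q. f q + f' q) = v f + v f' \<and>
            v (\<lambda>q. f q * f' q) = f p * v f' + f' p * v f) \<and>
         (\<forall>c f. smooth_function M f \<longrightarrow> v (\<lambda>q. c * f q) = c * v f) \<and>
         (\<forall>f. \<not> smooth_function M f \<longrightarrow> v f = 0)}"

type_synonym 'a vector_field = "'a \<Rightarrow> 'a tangent_vector"

definition derivative_along :: "'a vector_field \<Rightarrow> ('a \<Rightarrow> real) \<Rightarrow> 'a \<Rightarrow> real" where
  "derivative_along X f = (\<lambda>p. X p f)"

definition vector_fields :: "('a, 'e::euclidean_space) atlas_space \<Rightarrow> 'a vector_field set" where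
  "vector_fields M =
     {X. (\<forall>p\<in>points M. X p \<in> tangent_space M p) \<and> (\<forall>p. p \<notin> points M \<longrightarrow> X p = 0) \<and>
         (\<forall>f. smooth_function M f \<longrightarrow> smooth_function M (derivative_along X f))}"

definition field_scale :: "('a \<Rightarrow> real) \<Rightarrow> 'a vector_field \<Rightarrow> 'a vector_field" where
  "field_scale f X = (\<lambda>p. f p *\<^sub>R X p)"

text \<open>The case distinction only implements the convention that tangent vectors vanish on
  functions that are not smooth.\<close>

definition lie_bracket ::
    "('a, 'e::euclidean_space) atlas_space \<Rightarrow> 'a vector_field \<Rightarrow> 'a vector_field \<Rightarrow> 'a vector_field" where
  "lie_bracket M X Y = (\<lambda>p f. if smooth_function M f
     then X p (derivative_along Y f) - Y p (derivative_along X f) else 0)"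

type_synonym 'a one_form = "'a \<Rightarrow> 'a tangent_vector \<Rightarrow> real"

definition one_forms :: "('a, 'e::euclidean_space) atlas_space \<Rightarrow> 'a one_form set" where
  "one_forms M =
     {\<phi>. (\<forall>p\<in>points M. linear_form_on (tangent_space M p) (\<phi> p)) \<and>
         (\<forall>X\<in>vector_fields M. smooth_function M (\<lambda>p. \<phi> p (X p)))}"

definition exterior_derivative ::
    "('a, 'e::euclidean_space) atlas_space \<Rightarrow> 'a one_form \<Rightarrow> 'a vector_field \<Rightarrow> 'a vector_field \<Rightarrow> 'a \<Rightarrow> real" where
  "exterior_derivative M \<phi> X Y p =
     derivative_along X (\<lambda>q. \<phi> q (Y q)) p - derivative_along Y (\<lambda>q. \<phi> q (X q)) p
     - \<phi> p (lie_bracket M X Y p)"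

definition closed_one_forms :: "('a, 'e::euclidean_space) atlas_space \<Rightarrow> 'a one_form set" where
  "closed_one_forms M =
     {\<phi> \<in> one_forms M. \<forall>X\<in>vector_fields M. \<forall>Y\<in>vector_fields M. \<forall>p\<in>points M.
        exterior_derivative M \<phi> X Y p = 0}"

definition exact_one_forms :: "('a, 'e::euclidean_space) atlas_space \<Rightarrow> 'a one_form set" where
  "exact_one_forms M =
     {\<phi> \<in> one_forms M. \<exists>f. smooth_function M f \<and>
        (\<forall>p\<in>points M. \<forall>v\<in>tangent_space M p. \<phi> p v = v f)}"

definition cohomologous :: "('a, 'e::euclidean_space) atlas_space \<Rightarrow> ('a one_form \<times> 'a one_form) set" where
  "cohomologous M = {(\<alpha>, \<beta>) \<in> closed_one_forms M \<times> closed_one_forms M.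
     (\<lambda>p v. \<alpha> p v - \<beta> p v) \<in> exact_one_forms M}"

definition de_Rham_H1 :: "('a, 'e::euclidean_space) atlas_space \<Rightarrow> 'a one_form set set" where
  "de_Rham_H1 M = closed_one_forms M // cohomologous M"

definition de_Rham_H1_zero :: "('a, 'e::euclidean_space) atlas_space \<Rightarrow> 'a one_form set" where
  "de_Rham_H1_zero M = cohomologous M `` {\<lambda>p v. 0}"


section \<open>Metrics and connections\<close>

type_synonym 'a metric_tensor = "'a \<Rightarrow> 'a tangent_vector \<Rightarrow> 'a tangent_vector \<Rightarrow> real"

definition pseudo_riemannian_metric ::
    "('a, 'e::euclidean_space) atlas_space \<Rightarrow> 'a metric_tensor \<Rightarrow> bool" where
  "pseudo_riemannian_metric M g \<longleftrightarrow>
     (\<forall>p\<in>points M. inner_product_on (tangent_space M p) (g p)) \<and>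
     (\<forall>X\<in>vector_fields M. \<forall>Y\<in>vector_fields M. smooth_function M (\<lambda>p. g p (X p) (Y p)))"

type_synonym 'a connection = "'a vector_field \<Rightarrow> 'a vector_field \<Rightarrow> 'a vector_field"

definition affine_connection ::
    "('a, 'e::euclidean_space) atlas_space \<Rightarrow> 'a connection \<Rightarrow> bool" where
  "affine_connection M D \<longleftrightarrow>
     (\<forall>X\<in>vector_fields M. \<forall>Y\<in>vector_fields M. D X Y \<in> vector_fields M) \<and>
     (\<forall>X\<in>vector_fields M. \<forall>X'\<in>vector_fields M. \<forall>Y\<in>vector_fields M.
        D (X + X') Y = D X Y + D X' Y) \<and>
     (\<forall>X\<in>vector_fields M. \<forall>Y\<in>vector_fields M. \<forall>Y'\<in>vector_fields M.
        D X (Y + Y') = D X Y + D X Y') \<and>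
     (\<forall>f. smooth_function M f \<longrightarrow> (\<forall>X\<in>vector_fields M. \<forall>Y\<in>vector_fields M.
        D (field_scale f X) Y = field_scale f (D X Y) \<and>
        D X (field_scale f Y) = field_scale (derivative_along X f) Y + field_scale f (D X Y)))"

definition torsion_free :: "('a, 'e::euclidean_space) atlas_space \<Rightarrow> 'a connection \<Rightarrow> bool" where
  "torsion_free M D \<longleftrightarrow>
     (\<forall>X\<in>vector_fields M. \<forall>Y\<in>vector_fields M. D X Y - D Y X = lie_bracket M X Y)"

text \<open>The function \<open>(\<nabla>\<^sub>X g)(Y, Z)\<close>.\<close>

definition covariant_derivative_metric ::
    "'a connection \<Rightarrow> 'a metric_tensor \<Rightarrow> 'a vector_field \<Rightarrow> 'a vector_field \<Rightarrow> 'a vector_field \<Rightarrow> 'a \<Rightarrow> real" where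
  "covariant_derivative_metric D g X Y Z p =
     derivative_along X (\<lambda>q. g q (Y q) (Z q)) p - g p (D X Y p) (Z p) - g p (Y p) (D X Z p)"

definition weyl_manifold ::
    "('a, 'e::euclidean_space) atlas_space \<Rightarrow> 'a metric_tensor \<Rightarrow> 'a connection \<Rightarrow> bool" where
  "weyl_manifold M g D \<longleftrightarrow>
     smooth_manifold M \<and> pseudo_riemannian_metric M g \<and> affine_connection M D \<and> torsion_free M D \<and>
     (\<exists>\<phi>\<in>one_forms M. \<forall>X\<in>vector_fields M. \<forall>Y\<in>vector_fields M. \<forall>Z\<in>vector_fields M. \<forall>p\<in>points M.
        covariant_derivative_metric D g X Y Z p = - 2 * \<phi> p (X p) * g p (Y p) (Z p))"

definition levi_civita_connection ::
    "('a, 'e::euclidean_space) atlas_space \<Rightarrow> 'a metric_tensor \<Rightarrow> 'a connection \<Rightarrow> bool" where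
  "levi_civita_connection M g D \<longleftrightarrow>
     pseudo_riemannian_metric M g \<and> affine_connection M D \<and> torsion_free M D \<and>
     (\<forall>X\<in>vector_fields M. \<forall>Y\<in>vector_fields M. \<forall>Z\<in>vector_fields M. \<forall>p\<in>points M.
        covariant_derivative_metric D g X Y Z p = 0)"

definition curvature_operator ::
    "('a, 'e::euclidean_space) atlas_space \<Rightarrow> 'a connection \<Rightarrow>
     'a vector_field \<Rightarrow> 'a vector_field \<Rightarrow> 'a vector_field \<Rightarrow> 'a vector_field" where
  "curvature_operator M D X Y Z = D X (D Y Z) - D Y (D X Z) - D (lie_bracket M X Y) Z"

text \<open>The value at \<open>p\<close> of the curvature on vector fields depends only on the values of these
  fields at \<open>p\<close>, so the tensor on the tangent space is obtained from arbitrary extensions of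
  tangent vectors to vector fields.\<close>

definition extension_field ::
    "('a, 'e::euclidean_space) atlas_space \<Rightarrow> 'a \<Rightarrow> 'a tangent_vector \<Rightarrow> 'a vector_field" where
  "extension_field M p v = (SOME X. X \<in> vector_fields M \<and> X p = v)"

definition curvature_tensor ::
    "('a, 'e::euclidean_space) atlas_space \<Rightarrow> 'a metric_tensor \<Rightarrow> 'a connection \<Rightarrow>
     'a \<Rightarrow> 'a tangent_vector tensor4" where
  "curvature_tensor M g D p x y z w =
     g p (curvature_operator M D (extension_field M p x) (extension_field M p y)
            (extension_field M p z) p) w"

end

(* For a Weyl tensor A write A(x,y,z,w) + A(x,y,w,z) = F(x,y) h(z,w). The Bianchi identity for the
   conjugate tensor then says that the cyclic sum of F(x,y) h(z,w) over x, y, z vanishes for all w,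
   that is F(x,y) z + F(y,z) x + F(z,x) y = 0. In dimension at least 3 some z is independent of x
   and y, so F(x,y) = 0.

   For a Weyl structure with form phi the curvature satisfies
   R(x,y,z,w) + R(x,y,w,z) = 2 dphi(x,y) g(z,w), so the same argument at each point gives dphi = 0.
   As the first cohomology vanishes, phi = df, and e^(2f) g is parallel.

   Tangent vectors are derivations of the global smooth functions. Expanding a smooth function by
   Hadamard's lemma in a chart, cut off by a bump function, shows that locally every vector field
   is a combination of globally defined coordinate fields with smooth coefficients. This extends
   tangent vectors to vector fields and makes dphi tensorial. *)
theory Submission
  imports Defs
begin

section \<open>Smooth functions on Euclidean space\<close>

text \<open>The independent third vector is found differently in the two parts. In \<open>V\<close>
  its absence would contradict the dimension. On the manifold the vector identity at a point is
  evaluated on a cut-off coordinate function in a third coordinate direction, which annihilates the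
  two other frame vectors, so the dimension enters through the number of coordinate directions. The
  curvature tensor at a point is built from chosen extensions of tangent vectors. The curvature
  relations are therefore proved for arbitrary vector fields and applied to exactly these
  extensions; what is then transferred to other fields is dphi. Derivations act only on functions
  smooth on all of \<open>M\<close>, so every local object must be multiplied by a bump before a
  derivation may be applied to it. The bump is exp(-1/t) with t = r^2 - |x - a|^2. It is positive at
  the centre but not constant near it, so the local identities carry a power of the cutoff, which is
  divided out at the centre.\<close>

lemma Ck_on_Suc_has_derivative:
  assumes "Ck_on (Suc k) S f" "x \<in> S"
  shows "(f has_derivative frechet_derivative f (at x)) (at x)"
  using assms by (simp add: frechet_derivative_works)

text \<open>Since \<open>S\<close> is open, the derivative at a point of \<open>S\<close> only sees
  values taken in \<open>S\<close>, so agreement on \<open>S\<close> passes to the derivatives of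
  every order.\<close>

lemma Ck_on_cong:
  assumes "open S" "\<And>x. x \<in> S \<Longrightarrow> f x = g x" "Ck_on k S f"
  shows "Ck_on k S g"
  using assms(2,3)
proof (induction k arbitrary: f g)
  case 0
  then show ?case by (auto cong: continuous_on_cong)
next
  case (Suc k)
  have g: "(g has_derivative frechet_derivative f (at x)) (at x)" if "x \<in> S" for x
    using Ck_on_Suc_has_derivative[OF Suc.prems(2) that]
    by (rule has_derivative_transform_within_open[OF _ assms(1) that]) (use Suc.prems in auto)
  have "Ck_on k S (\<lambda>x. frechet_derivative g (at x) v)" for v
  proof (rule Suc.IH)
    show "Ck_on k S (\<lambda>x. frechet_derivative f (at x) v)"
      using Suc.prems(2) by simp
  qed (simp add: frechet_derivative_at[OF g])
  then show ?case using g unfolding Ck_on.simps differentiable_def by blast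
qed

text \<open>Allows the derivative to be given by an explicit formula in place of
  \<open>frechet_derivative\<close>; the inductions on the order below rest on this form.\<close>

lemma Ck_on_SucI:
  assumes "open S" "\<And>x. x \<in> S \<Longrightarrow> (f has_derivative f' x) (at x)"
    and "\<And>v. Ck_on k S (\<lambda>x. f' x v)"
  shows "Ck_on (Suc k) S f"
proof -
  have "Ck_on k S (\<lambda>x. frechet_derivative f (at x) v)" for v
    by (rule Ck_on_cong[OF assms(1) _ assms(3)[of v]]) (simp add: frechet_derivative_at[OF assms(2)])
  with assms(2) show ?thesis unfolding Ck_on.simps differentiable_def by blast
qed

lemma Ck_on_subset: "Ck_on k S f \<Longrightarrow> T \<subseteq> S \<Longrightarrow> Ck_on k T f"
  by (induction k arbitrary: f) (auto intro: continuous_on_subset)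

lemma Ck_on_Suc_imp_Ck_on: "Ck_on (Suc k) S f \<Longrightarrow> Ck_on k S f"
proof (induction k arbitrary: f)
  case 0
  then show ?case
    by (auto intro!: continuous_at_imp_continuous_on differentiable_imp_continuous_within)
next
  case (Suc k)
  show ?case
    unfolding Ck_on.simps(2)[of k]
    using Suc.prems Suc.IH unfolding Ck_on.simps(2)[of "Suc k"] by blast
qed

lemma Ck_on_Un:
  assumes "open S" "open T" "Ck_on k S f" "Ck_on k T f"
  shows "Ck_on k (S \<union> T) f"
  using assms(3,4)
  by (induction k arbitrary: f) (auto intro: continuous_on_open_Un[OF assms(1,2)])

lemma Ck_on_const: "open S \<Longrightarrow> Ck_on k S (\<lambda>x. c)"
proof (induction k arbitrary: c)
  case (Suc k)
  from Suc.IH[OF Suc.prems] show ?case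
    by (intro Ck_on_SucI[OF Suc.prems has_derivative_const])
qed simp

lemma Ck_on_bounded_linear_compose:
  assumes "open S" "bounded_linear L" "Ck_on k S f"
  shows "Ck_on k S (\<lambda>x. L (f x))"
  using assms(3)
proof (induction k arbitrary: f)
  case 0
  then show ?case using assms(2) by (auto intro: bounded_linear.continuous_on)
next
  case (Suc k)
  show ?case
  proof (rule Ck_on_SucI[OF assms(1)])
    show "((\<lambda>x. L (f x)) has_derivative (\<lambda>v. L (frechet_derivative f (at x) v))) (at x)"
      if "x \<in> S" for x
      by (rule bounded_linear.has_derivative[OF assms(2) Ck_on_Suc_has_derivative[OF Suc.prems that]])
    show "Ck_on k S (\<lambda>x. L (frechet_derivative f (at x) v))" for v
      using Suc by simp
  qed
qed

lemma Ck_on_add: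
  assumes "open S" "Ck_on k S f" "Ck_on k S g"
  shows "Ck_on k S (\<lambda>x. f x + g x)"
  using assms(2,3)
proof (induction k arbitrary: f g)
  case 0
  then show ?case by (auto intro: continuous_on_add)
next
  case (Suc k)
  show ?case
  proof (rule Ck_on_SucI[OF assms(1)])
    show "((\<lambda>x. f x + g x) has_derivative
        (\<lambda>v. frechet_derivative f (at x) v + frechet_derivative g (at x) v)) (at x)"
      if "x \<in> S" for x
      by (rule has_derivative_add[OF Suc.prems[THEN Ck_on_Suc_has_derivative, OF that]])
    show "Ck_on k S (\<lambda>x. frechet_derivative f (at x) v + frechet_derivative g (at x) v)" for v
      using Suc by simp
  qed
qed

lemma Ck_on_sum:
  assumes "open S" "\<And>i. i \<in> I \<Longrightarrow> Ck_on k S (f i)"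
  shows "Ck_on k S (\<lambda>x. \<Sum>i\<in>I. f i x)"
  using assms(2)
proof (induction I rule: infinite_finite_induct)
qed (auto intro: Ck_on_const Ck_on_add assms(1))

text \<open>By the Leibniz rule the derivative in a fixed direction is a sum of two products of the
  same kind, with one factor differentiated in each. The induction hypothesis applies to both
  because the other factor also has order \<open>k\<close>.\<close>

lemma Ck_on_bounded_bilinear:
  assumes "open S" "bounded_bilinear B" "Ck_on k S f" "Ck_on k S g"
  shows "Ck_on k S (\<lambda>x. B (f x) (g x))"
  using assms(3,4)
proof (induction k arbitrary: f g)
  case 0
  then show ?case using assms(2) by (auto intro: bounded_bilinear.continuous_on)
next
  case (Suc k)
  show ?case
  proof (rule Ck_on_SucI[OF assms(1)])
    show "((\<lambda>x. B (f x) (g x)) has_derivative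
        (\<lambda>v. B (f x) (frechet_derivative g (at x) v) + B (frechet_derivative f (at x) v) (g x))) (at x)"
      if "x \<in> S" for x
      by (rule bounded_bilinear.FDERIV[OF assms(2) Suc.prems[THEN Ck_on_Suc_has_derivative, OF that]])
    show "Ck_on k S (\<lambda>x. B (f x) (frechet_derivative g (at x) v) + B (frechet_derivative f (at x) v) (g x))" for v
      using Suc.prems Suc.prems[THEN Ck_on_Suc_imp_Ck_on]
      by (intro Ck_on_add[OF assms(1)] Suc.IH) simp_all
  qed
qed

text \<open>In the chain rule the outer derivative is taken in the direction \<open>?g' x v\<close>,
  which varies with \<open>x\<close>, whereas \<open>Ck_on\<close> only controls fixed directions.
  Expanding that direction in the finite basis gives a sum of products in which each outer
  derivative has a fixed direction.\<close>

lemma Ck_on_compose: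
  fixes f :: "'b::euclidean_space \<Rightarrow> 'c::real_normed_vector"
  assumes "open S" "open T" "g ` S \<subseteq> T" "Ck_on k T f" "Ck_on k S g"
  shows "Ck_on k S (\<lambda>x. f (g x))"
  using assms(4,5)
proof (induction k arbitrary: f)
  case 0
  then show ?case using assms(3) by (auto intro: continuous_on_compose2)
next
  case (Suc k)
  let ?f' = "\<lambda>x. frechet_derivative f (at x)" and ?g' = "\<lambda>x. frechet_derivative g (at x)"
  have expand: "?f' (g x) (?g' x v) = (\<Sum>b\<in>Basis. (?g' x v \<bullet> b) *\<^sub>R ?f' (g x) b)" if "x \<in> S" for x v
  proof -
    have "linear (?f' (g x))"
      using Ck_on_Suc_has_derivative[OF Suc.prems(1), of "g x"] assms(3) that
      by (auto intro: has_derivative_linear)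
    then have "?f' (g x) (\<Sum>b\<in>Basis. (?g' x v \<bullet> b) *\<^sub>R b) = (\<Sum>b\<in>Basis. (?g' x v \<bullet> b) *\<^sub>R ?f' (g x) b)"
      by (simp add: linear_sum linear_cmul)
    then show ?thesis by (simp add: euclidean_representation)
  qed
  show ?case
  proof (rule Ck_on_SucI[OF assms(1)])
    show "((\<lambda>x. f (g x)) has_derivative (\<lambda>v. ?f' (g x) (?g' x v))) (at x)" if "x \<in> S" for x
    proof -
      have "(f has_derivative ?f' (g x)) (at (g x))"
        using that assms(3) by (intro Ck_on_Suc_has_derivative[OF Suc.prems(1)]) auto
      with Ck_on_Suc_has_derivative[OF Suc.prems(2) that] show ?thesis
        by (rule has_derivative_compose)
    qed
    fix v
    have "Ck_on k S (\<lambda>x. \<Sum>b\<in>Basis. (?g' x v \<bullet> b) *\<^sub>R ?f' (g x) b)"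
    proof (intro Ck_on_sum assms Ck_on_bounded_bilinear[OF _ bounded_bilinear_scaleR])
      fix b :: 'b assume "b \<in> Basis"
      show "Ck_on k S (\<lambda>x. ?g' x v \<bullet> b)"
        using Suc.prems(2)
        by (intro Ck_on_bounded_linear_compose[OF assms(1) bounded_linear_inner_left]) simp
      show "Ck_on k S (\<lambda>x. ?f' (g x) b)"
        using Suc.prems Ck_on_Suc_imp_Ck_on[OF Suc.prems(2)] by (intro Suc.IH) simp_all
    qed
    then show "Ck_on k S (\<lambda>x. ?f' (g x) (?g' x v))"
      by (rule Ck_on_cong[OF assms(1), rotated]) (simp add: expand)
  qed
qed

lemma Ck_on_bounded_linear: "open S \<Longrightarrow> bounded_linear L \<Longrightarrow> Ck_on k S L"
proof (cases k)
  case (Suc j)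
  assume "open S" "bounded_linear L"
  then show ?thesis
    unfolding Suc by (intro Ck_on_SucI[where f' = "\<lambda>_. L"] Ck_on_const bounded_linear_imp_has_derivative)
qed (simp add: linear_continuous_on)

lemma Ck_on_exp: "Ck_on k UNIV (exp :: real \<Rightarrow> real)"
proof (induction k)
  case (Suc k)
  have "Ck_on k UNIV (\<lambda>x. exp x * v)" for v :: real
    using Ck_on_bounded_linear_compose[OF open_UNIV bounded_linear_mult_left Suc] .
  moreover have "(exp has_derivative (\<lambda>v. exp x * v)) (at x)" for x :: real
    using DERIV_exp[of x] by (simp add: has_field_derivative_def)
  ultimately show ?case by (intro Ck_on_SucI[OF open_UNIV]) auto
qed (simp add: continuous_on_exp continuous_on_id)

lemma Ck_on_imp_continuous_on: "Ck_on k S f \<Longrightarrow> continuous_on S f"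
proof (induction k)
  case (Suc k)
  from Suc.IH[OF Ck_on_Suc_imp_Ck_on[OF Suc.prems]] show ?case .
qed simp

section \<open>Differentiation under the integral and Hadamard's lemma\<close>

lemma Ck_on_integral_parametric:
  fixes f :: "'e::euclidean_space \<times> real \<Rightarrow> 'f::banach"
  assumes S: "open S" "convex S" and T: "S \<times> {0..1} \<subseteq> T" and f: "Ck_on k T f"
  shows "Ck_on k S (\<lambda>x. integral {0..1} (\<lambda>t. f (x, t)))"
  using f
proof (induction k arbitrary: f)
  case 0
  then have "continuous_on (S \<times> cbox 0 1) (\<lambda>(x, t). f (x, t))"
    using T by (auto intro: continuous_on_subset simp: case_prod_unfold)
  from integral_continuous_on_param[OF this] show ?case by simp
next
  case (Suc k)
  let ?f' = "\<lambda>x. frechet_derivative f (at x)"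
  \<comment> \<open>\<open>leibniz_rule\<close> wants the derivative as a continuous map into
    bounded linear operators. \<open>Ck_on\<close> gives continuity in each fixed direction, which
    is enough in finite dimension. The integral's derivative in direction \<open>v\<close> is again
    an integral, of \<open>?f' (x, t) (v, 0)\<close>, so the induction closes.\<close>
  define F where "F x t = Blinfun (\<lambda>v. ?f' (x, t) (v, 0))" for x t
  have f': "(f has_derivative ?f' (x, t)) (at (x, t))" if "x \<in> S" "t \<in> {0..1}" for x t
    using that T by (intro Ck_on_Suc_has_derivative[OF Suc.prems]) auto
  have F: "blinfun_apply (F x t) = (\<lambda>v. ?f' (x, t) (v, 0))" if "x \<in> S" "t \<in> {0..1}" for x t
    unfolding F_def
    by (intro bounded_linear_Blinfun_apply bounded_linear_compose[OF has_derivative_bounded_linear[OF f'[OF that]]]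
        bounded_linear_Pair bounded_linear_ident bounded_linear_zero)
  have f'k: "Ck_on k T (\<lambda>y. ?f' y v)" for v
    using Suc.prems[unfolded Ck_on.simps(2)] by (elim conjE allE)
  have cont': "continuous_on (S \<times> {0..1}) (\<lambda>y. ?f' y v)" for v
    by (rule continuous_on_subset[OF Ck_on_imp_continuous_on[OF f'k] T])
  have "continuous_on (S \<times> {0..1}) (\<lambda>y. blinfun_apply (F (fst y) (snd y)) v)" for v
    by (rule continuous_on_eq[OF cont'[of "(v, 0)"]]) (auto simp: F)
  then have contF: "continuous_on (S \<times> cbox 0 1) (\<lambda>(x, t). F x t)"
    unfolding case_prod_unfold by (intro continuous_on_blinfun_componentwise) simp
  show ?case
  proof (rule Ck_on_SucI[OF S(1)])
    fix x assume x: "x \<in> S"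
    have "((\<lambda>x. integral (cbox 0 1) (\<lambda>t. f (x, t))) has_derivative integral (cbox 0 1) (F x)) (at x within S)"
    proof (rule leibniz_rule[OF _ _ contF x S(2)])
      show "((\<lambda>x. f (x, t)) has_derivative blinfun_apply (F x t)) (at x within S)"
        if "x \<in> S" "t \<in> cbox 0 1" for x t
      proof -
        have "((\<lambda>x. (x, t)) has_derivative (\<lambda>v. (v, 0))) (at x within S)"
          by (auto intro!: derivative_eq_intros)
        from has_derivative_compose[OF this f'] show ?thesis using that by (simp add: F)
      qed
      show "(\<lambda>t. f (x, t)) integrable_on cbox 0 1" if "x \<in> S" for x
      proof (rule integrable_continuous)
        have "continuous_on (S \<times> {0..1}) f"
          using Ck_on_imp_continuous_on[OF Suc.prems] T by (rule continuous_on_subset)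
        then show "continuous_on (cbox 0 1) (\<lambda>t. f (x, t))"
          by (rule continuous_on_compose2) (use that in \<open>auto intro!: continuous_intros\<close>)
      qed
    qed
    moreover have "F x integrable_on cbox 0 1"
    proof (rule integrable_continuous)
      show "continuous_on (cbox 0 1) (F x)"
        by (rule continuous_on_compose2[OF contF, of _ "\<lambda>t. (x, t)", simplified])
           (use x in \<open>auto intro!: continuous_intros\<close>)
    qed
    then have "blinfun_apply (integral (cbox 0 1) (F x)) = (\<lambda>v. integral (cbox 0 1) (\<lambda>t. ?f' (x, t) (v, 0)))"
      by (intro ext) (subst blinfun_apply_integral, auto intro!: integral_cong simp: F x)
    ultimately show "((\<lambda>x. integral {0..1} (\<lambda>t. f (x, t))) has_derivative
        (\<lambda>v. integral {0..1} (\<lambda>t. ?f' (x, t) (v, 0)))) (at x)"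
      unfolding at_within_open[OF x S(1)] by (simp only: cbox_interval)
  next
    show "Ck_on k S (\<lambda>x. integral {0..1} (\<lambda>t. ?f' (x, t) (v, 0)))" for v by (rule Suc.IH[OF f'k])
  qed
qed

text \<open>The derivative of f(a + t(x - a)) in t is integrated over [0,1] and expanded in the
  basis, so \<open>g b\<close> is the average of the partial derivative in direction
  \<open>b\<close> along the segment from \<open>a\<close> to \<open>x\<close>. Convexity keeps the
  segment inside \<open>S\<close>.\<close>

lemma smooth_on_Hadamard:
  fixes f :: "'e::euclidean_space \<Rightarrow> real"
  assumes S: "open S" "convex S" and f: "smooth_on S f" and a: "a \<in> S"
  shows "\<exists>g. (\<forall>b. smooth_on S (g b) \<and> g b a = frechet_derivative f (at a) b) \<and>
    (\<forall>x\<in>S. f x = f a + (\<Sum>b\<in>Basis. ((x - a) \<bullet> b) * g b x))"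
proof -
  let ?f' = "\<lambda>x. frechet_derivative f (at x)"
  let ?l = "\<lambda>(x, t). a + t *\<^sub>R (x - a)"
  define g where "g b x = integral {0..1} (\<lambda>t. ?f' (?l (x, t)) b)" for b x
  have f': "(f has_derivative ?f' x) (at x)" if "x \<in> S" for x
    using f that Ck_on_Suc_has_derivative[of 0] unfolding smooth_on_def by blast
  have f'smooth: "Ck_on k S (\<lambda>x. ?f' x b)" for k b
    using f unfolding smooth_on_def by (metis Ck_on.simps(2))
  \<comment> \<open>\<open>Ck_on\<close> takes derivatives in all directions of the product space,
    also at t = 0 and t = 1, so the integrand is considered on an open set around S x [0,1].\<close>
  define T where "T = ?l -` S"
  have contl: "continuous_on UNIV ?l"
    by (auto simp: case_prod_unfold intro!: continuous_intros)
  have T: "open T" unfolding T_def using S(1) contl by (rule open_vimage)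
  have seg: "a + t *\<^sub>R (x - a) \<in> S" if "x \<in> S" "t \<in> {0..1}" for x t
    using convexD_alt[OF S(2) a that(1), of t] that(2) by (simp add: algebra_simps)
  have l: "Ck_on k T ?l" for k
    unfolding case_prod_unfold diff_conv_add_uminus
    by (intro Ck_on_add Ck_on_const Ck_on_bounded_bilinear[OF _ bounded_bilinear_scaleR]
        Ck_on_bounded_linear bounded_linear_fst bounded_linear_snd T)
  have g_smooth: "smooth_on S (g b)" for b
    unfolding smooth_on_def g_def
  proof
    fix k
    show "Ck_on k S (\<lambda>x. integral {0..1} (\<lambda>t. ?f' (?l (x, t)) b))"
    proof (rule Ck_on_integral_parametric[OF S, of T])
      show "S \<times> {0..1} \<subseteq> T" unfolding T_def using seg by auto
      show "Ck_on k T (\<lambda>y. ?f' (?l y) b)"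
        by (rule Ck_on_compose[OF T S(1) _ f'smooth l]) (auto simp: T_def)
    qed
  qed
  have g_a: "g b a = ?f' a b" for b unfolding g_def by simp
  have expansion: "f x = f a + (\<Sum>b\<in>Basis. ((x - a) \<bullet> b) * g b x)" if x: "x \<in> S" for x
  proof -
    have "((\<lambda>t. ?f' (a + t *\<^sub>R (x - a)) (x - a)) has_integral f (a + 1 *\<^sub>R (x - a)) - f (a + 0 *\<^sub>R (x - a))) {0..1}"
    proof (rule fundamental_theorem_of_calculus)
      fix t :: real assume t: "t \<in> {0..1}"
      have "((\<lambda>t. a + t *\<^sub>R (x - a)) has_derivative (\<lambda>s. s *\<^sub>R (x - a))) (at t within {0..1})"
        by (auto intro!: derivative_eq_intros)
      from has_derivative_compose[OF this f'[OF seg[OF x t]]]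
      show "((\<lambda>t. f (a + t *\<^sub>R (x - a))) has_vector_derivative ?f' (a + t *\<^sub>R (x - a)) (x - a)) (at t within {0..1})"
        unfolding has_vector_derivative_def
        by (simp add: linear_cmul[OF has_derivative_linear[OF f'[OF seg[OF x t]]]])
    qed simp
    then have "((\<lambda>t. ?f' (a + t *\<^sub>R (x - a)) (x - a)) has_integral f x - f a) {0..1}" by simp
    moreover have "((\<lambda>t. ?f' (a + t *\<^sub>R (x - a)) (x - a)) has_integral
        (\<Sum>b\<in>Basis. ((x - a) \<bullet> b) * g b x)) {0..1}"
    proof (rule has_integral_eq)
      show "((\<lambda>t. \<Sum>b\<in>Basis. ((x - a) \<bullet> b) * ?f' (a + t *\<^sub>R (x - a)) b) has_integral
        (\<Sum>b\<in>Basis. ((x - a) \<bullet> b) * g b x)) {0..1}"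
      proof (intro has_integral_sum has_integral_mult_right finite_Basis)
        fix b :: 'e
        have "continuous_on {0..1} (\<lambda>t. ?f' (a + t *\<^sub>R (x - a)) b)"
          by (rule continuous_on_compose2[OF Ck_on_imp_continuous_on[OF f'smooth]])
             (use x seg in \<open>auto intro!: continuous_intros\<close>)
        then show "((\<lambda>t. ?f' (a + t *\<^sub>R (x - a)) b) has_integral g b x) {0..1}"
          unfolding g_def by (simp add: integrable_integral integrable_continuous_interval)
      qed
      fix t :: real assume t: "t \<in> {0..1}"
      have "?f' (a + t *\<^sub>R (x - a)) (\<Sum>b\<in>Basis. ((x - a) \<bullet> b) *\<^sub>R b)
          = (\<Sum>b\<in>Basis. ((x - a) \<bullet> b) * ?f' (a + t *\<^sub>R (x - a)) b)"
        using has_derivative_linear[OF f'[OF seg[OF x t]]] by (simp add: linear_sum linear_cmul)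
      then show "(\<Sum>b\<in>Basis. ((x - a) \<bullet> b) * ?f' (a + t *\<^sub>R (x - a)) b) = ?f' (a + t *\<^sub>R (x - a)) (x - a)"
        by (simp add: euclidean_representation)
    qed
    ultimately have "f x - f a = (\<Sum>b\<in>Basis. ((x - a) \<bullet> b) * g b x)" by (rule has_integral_unique)
    then show ?thesis by linarith
  qed
  show ?thesis using g_smooth g_a expansion by (intro exI[of _ g]) simp
qed

text \<open>Derivatives of \<open>flat k\<close> are combinations of functions of the same family, which makes the
  induction in \<open>Ck_on_flat\<close> work.\<close>

definition flat :: "nat \<Rightarrow> real \<Rightarrow> real" where
  "flat k t = (if t \<le> 0 then 0 else inverse t ^ k * exp (- inverse t))"

lemma flat_pos: "0 < t \<Longrightarrow> 0 < flat k t"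
  by (simp add: flat_def)

lemma flat_nonpos: "t \<le> 0 \<Longrightarrow> flat k t = 0"
  by (simp add: flat_def)

text \<open>For positive \<open>t\<close> the exponential contributes two extra powers of 1/t and
  the power contributes one. At 0 the exponential decay beats every power of 1/t.\<close>

lemma has_real_derivative_flat:
  "(flat k has_real_derivative (flat (k + 2) t - k * flat (k + 1) t)) (at t)"
proof (cases t "0 :: real" rule: linorder_cases)
  case less
  have "((\<lambda>_. 0) has_real_derivative 0) (at t)" by simp
  then have "(flat k has_real_derivative 0) (at t)"
    by (rule has_field_derivative_transform_within_open[of _ _ _ "{..<0}"]) (use less in \<open>auto simp: flat_def\<close>)
  then show ?thesis using less by (simp add: flat_def)
next
  case equal
  \<comment> \<open>Here s stands for 1/t. The exponent is \<open>k + 1\<close> because the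
    difference quotient at 0 divides by one more t.\<close>
  have "((\<lambda>s. s ^ (k + 1) / exp s) \<longlongrightarrow> (0 :: real)) at_top"
    by (rule tendsto_power_div_exp_0)
  then have "((\<lambda>s. inverse s ^ (k + 1) / exp (inverse s)) \<longlongrightarrow> (0 :: real)) (at_right 0)"
    by (simp add: filterlim_at_right_to_top)
  then have "((\<lambda>s. (flat k s - flat k 0) / (s - 0)) \<longlongrightarrow> 0) (at_right 0)"
    by (rule Lim_transform_eventually)
       (auto simp: eventually_at_filter flat_def exp_minus field_simps)
  moreover have "((\<lambda>s. (flat k s - flat k 0) / (s - 0)) \<longlongrightarrow> 0) (at_left 0)"
    by (rule Lim_transform_eventually[OF tendsto_const]) (auto simp: eventually_at_filter flat_def)
  ultimately have "(flat k has_real_derivative 0) (at 0)"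
    unfolding has_field_derivative_iff by (simp add: filterlim_split_at_real)
  then show ?thesis using equal by (simp add: flat_def)
next
  case greater
  have inv: "(inverse has_real_derivative - (inverse t ^ 2)) (at t)"
    using DERIV_inverse[of t UNIV] greater by (simp add: power2_eq_square)
  \<comment> \<open>The exponent \<open>k - 1\<close> is truncated subtraction; at
    \<open>k = 0\<close> the factor \<open>real k\<close> removes the term.\<close>
  have "((\<lambda>t. inverse t ^ k * exp (- inverse t)) has_real_derivative
      (real k * inverse t ^ (k - 1) * - (inverse t ^ 2)) * exp (- inverse t)
        + (exp (- inverse t) * (inverse t ^ 2)) * inverse t ^ k) (at t)"
    using DERIV_mult[OF DERIV_power[OF inv, of k] DERIV_chain2[OF DERIV_exp DERIV_minus[OF inv]]]
    by (simp add: mult_ac)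
  also have "(real k * inverse t ^ (k - 1) * - (inverse t ^ 2)) * exp (- inverse t)
        + (exp (- inverse t) * (inverse t ^ 2)) * inverse t ^ k
      = flat (k + 2) t - k * flat (k + 1) t"
    using greater by (cases k) (simp_all add: flat_def power2_eq_square mult_ac)
  finally have "((\<lambda>t. inverse t ^ k * exp (- inverse t)) has_real_derivative
      flat (k + 2) t - k * flat (k + 1) t) (at t)" .
  then show ?thesis
    by (rule has_field_derivative_transform_within_open[of _ _ _ "{0<..}"]) (use greater in \<open>auto simp: flat_def\<close>)
qed

lemma Ck_on_flat: "Ck_on k UNIV (flat m)"
proof (induction k arbitrary: m)
  case 0
  then show ?case
    by (auto intro!: DERIV_continuous_on has_real_derivative_flat intro: has_field_derivative_at_within)
next
  case (Suc k)
  show ?case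
  proof (rule Ck_on_SucI[OF open_UNIV])
    show "(flat m has_derivative (\<lambda>v. (flat (m + 2) t + (- real m) * flat (m + 1) t) * v)) (at t)" for t
      using has_real_derivative_flat[of m t] by (simp add: has_field_derivative_def)
    show "Ck_on k UNIV (\<lambda>t. (flat (m + 2) t + (- real m) * flat (m + 1) t) * v)" for v
      by (intro Ck_on_bounded_bilinear[OF _ bounded_bilinear_mult] Ck_on_add Ck_on_const Suc.IH open_UNIV)
  qed
qed

section \<open>Closure properties of smooth maps\<close>

lemma smooth_on_cong:
  "open S \<Longrightarrow> (\<And>x. x \<in> S \<Longrightarrow> f x = g x) \<Longrightarrow> smooth_on S f \<Longrightarrow> smooth_on S g"
  unfolding smooth_on_def by (meson Ck_on_cong)

lemma smooth_on_const: "open S \<Longrightarrow> smooth_on S (\<lambda>x. c)"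
  unfolding smooth_on_def by (simp add: Ck_on_const)

lemma smooth_on_add:
  "open S \<Longrightarrow> smooth_on S f \<Longrightarrow> smooth_on S g \<Longrightarrow> smooth_on S (\<lambda>x. f x + g x)"
  unfolding smooth_on_def by (simp add: Ck_on_add)

lemma smooth_on_bounded_bilinear:
  "open S \<Longrightarrow> bounded_bilinear B \<Longrightarrow> smooth_on S f \<Longrightarrow> smooth_on S g \<Longrightarrow> smooth_on S (\<lambda>x. B (f x) (g x))"
  unfolding smooth_on_def by (simp add: Ck_on_bounded_bilinear)

lemma smooth_on_bounded_linear: "open S \<Longrightarrow> bounded_linear L \<Longrightarrow> smooth_on S L"
  unfolding smooth_on_def by (simp add: Ck_on_bounded_linear)

lemma smooth_on_compose:
  fixes f :: "'b::euclidean_space \<Rightarrow> 'c::real_normed_vector"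
  shows "open S \<Longrightarrow> open T \<Longrightarrow> g ` S \<subseteq> T \<Longrightarrow> smooth_on T f \<Longrightarrow> smooth_on S g \<Longrightarrow> smooth_on S (\<lambda>x. f (g x))"
  unfolding smooth_on_def by (simp add: Ck_on_compose)

lemma smooth_on_subset: "smooth_on S f \<Longrightarrow> T \<subseteq> S \<Longrightarrow> smooth_on T f"
  unfolding smooth_on_def by (meson Ck_on_subset)

lemma smooth_on_Un: "open S \<Longrightarrow> open T \<Longrightarrow> smooth_on S f \<Longrightarrow> smooth_on T f \<Longrightarrow> smooth_on (S \<union> T) f"
  unfolding smooth_on_def by (simp add: Ck_on_Un)

lemma smooth_on_frechet_derivative:
  assumes "smooth_on S f"
  shows "smooth_on S (\<lambda>x. frechet_derivative f (at x) v)"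
  using assms unfolding smooth_on_def by (metis Ck_on.simps(2))

lemma smooth_on_has_derivative:
  assumes "smooth_on S f" "x \<in> S"
  shows "(f has_derivative frechet_derivative f (at x)) (at x)"
  using assms Ck_on_Suc_has_derivative[of 0] unfolding smooth_on_def by blast

section \<open>Smooth manifolds\<close>

locale manifold =
  fixes M :: "('a, 'e::euclidean_space) atlas_space"
  assumes smooth_manifold: "smooth_manifold M"
begin

lemma
  assumes "(U, c) \<in> atlas M"
  shows chart_openin: "openin (topology_of M) U"
    and chart_open: "open (c ` U)"
    and chart_homeomorphic: "homeomorphic_map (subtopology (topology_of M) U) (top_of_set (c ` U)) c"
    and chart_subset: "U \<subseteq> points M"
    and chart_transition: "(U', c') \<in> atlas M \<Longrightarrow> smooth_on (c ` (U \<inter> U')) (c' \<circ> inv_into U c)"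
proof -
  have all: "\<forall>(U, c)\<in>atlas M. openin (topology_of M) U \<and> open (c ` U) \<and>
        homeomorphic_map (subtopology (topology_of M) U) (top_of_set (c ` U)) c"
    using smooth_manifold unfolding smooth_manifold_def by (elim conjE)
  have trans: "\<forall>(U, c)\<in>atlas M. \<forall>(U', c')\<in>atlas M. smooth_on (c ` (U \<inter> U')) (c' \<circ> inv_into U c)"
    using smooth_manifold unfolding smooth_manifold_def by (elim conjE)
  show "openin (topology_of M) U" and "open (c ` U)"
    and "homeomorphic_map (subtopology (topology_of M) U) (top_of_set (c ` U)) c"
    using bspec[OF all assms] by simp_all
  then show "U \<subseteq> points M" unfolding points_def by (intro openin_subset)
  show "smooth_on (c ` (U \<inter> U')) (c' \<circ> inv_into U c)" if "(U', c') \<in> atlas M"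
    by (rule bspec[OF bspec[OF trans assms, unfolded prod.case] that, unfolded prod.case])
qed

section \<open>Topology of chart domains\<close>

lemma Hausdorff: "Hausdorff_space (topology_of M)"
  using smooth_manifold unfolding smooth_manifold_def by (elim conjE)

lemma chart_cover:
  assumes "p \<in> points M"
  obtains U c where "(U, c) \<in> atlas M" "p \<in> U"
proof -
  have "p \<in> (\<Union>(U, c)\<in>atlas M. U)"
    using smooth_manifold assms unfolding smooth_manifold_def by (elim conjE) simp
  then show ?thesis using that by auto
qed

lemma chart_topspace: "(U, c) \<in> atlas M \<Longrightarrow> topspace (subtopology (topology_of M) U) = U"
  using chart_subset[of U c] unfolding points_def by auto

lemma chart_inj_on: "(U, c) \<in> atlas M \<Longrightarrow> inj_on c U"
  using homeomorphic_imp_injective_map[OF chart_homeomorphic, of U c] chart_topspace by simp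

lemma chart_open_image:
  assumes U: "(U, c) \<in> atlas M" and W: "openin (topology_of M) W"
  shows "open (c ` (U \<inter> W))"
proof -
  have "openin (subtopology (topology_of M) U) (U \<inter> W)"
    using W by (rule openin_subtopology_Int2)
  then have "openin (top_of_set (c ` U)) (c ` (U \<inter> W))"
    using homeomorphic_imp_open_map[OF chart_homeomorphic[OF U]] unfolding open_map_def by blast
  then show ?thesis using chart_open[OF U] by (rule openin_open_trans)
qed

lemma chart_openin_preimage:
  assumes U: "(U, c) \<in> atlas M" and W: "open W"
  shows "openin (topology_of M) {q \<in> U. c q \<in> W}"
proof -
  have "openin (top_of_set (c ` U)) (c ` U \<inter> W)" using W by (rule openin_open_Int)
  from openin_continuous_map_preimage[OF homeomorphic_imp_continuous_map[OF chart_homeomorphic[OF U]] this]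
  have "openin (subtopology (topology_of M) U) {q \<in> U. c q \<in> c ` U \<inter> W}"
    unfolding chart_topspace[OF U] .
  moreover have "{q \<in> U. c q \<in> c ` U \<inter> W} = {q \<in> U. c q \<in> W}" by auto
  ultimately show ?thesis
    using openin_open_subtopology[OF chart_openin[OF U]] by metis
qed

text \<open>The chart carries compactness back to the manifold, where compact sets are closed by the
  Hausdorff property. This makes the complement of a bump's support open, so that the extension by
  zero is smooth.\<close>

lemma chart_closedin_preimage:
  assumes U: "(U, c) \<in> atlas M" and K: "compact K" "K \<subseteq> c ` U"
  shows "closedin (topology_of M) {q \<in> U. c q \<in> K}"
proof -
  have img: "c ` {q \<in> U. c q \<in> K} = K" using K(2) by auto
  have "compactin (top_of_set (c ` U)) (c ` {q \<in> U. c q \<in> K})"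
    unfolding img using K by (simp add: compactin_subtopology compactin_euclidean_iff)
  then have "compactin (subtopology (topology_of M) U) {q \<in> U. c q \<in> K}"
    using homeomorphic_map_compactness[OF chart_homeomorphic[OF U], of "{q \<in> U. c q \<in> K}"]
    unfolding chart_topspace[OF U] by auto
  then have "compactin (topology_of M) {q \<in> U. c q \<in> K}"
    by (simp add: compactin_subtopology)
  then show ?thesis by (rule compactin_imp_closedin[OF Hausdorff])
qed

section \<open>The algebra of smooth functions\<close>

lemma smooth_functionI:
  assumes "\<And>U c. (U, c) \<in> atlas M \<Longrightarrow> smooth_on (c ` U) (\<lambda>x. f (inv_into U c x))"
  shows "smooth_function M f"
  unfolding smooth_function_def comp_def by (rule ballI, clarify, rule assms)

lemma smooth_functionD:
  assumes "smooth_function M f" "(U, c) \<in> atlas M"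
  shows "smooth_on (c ` U) (\<lambda>x. f (inv_into U c x))"
  by (rule bspec[OF assms[unfolded smooth_function_def comp_def], unfolded prod.case])

lemma smooth_function_const: "smooth_function M (\<lambda>q. k)"
  by (rule smooth_functionI) (intro smooth_on_const chart_open)

lemma smooth_function_add:
  "smooth_function M f \<Longrightarrow> smooth_function M g \<Longrightarrow> smooth_function M (\<lambda>q. f q + g q)"
  by (rule smooth_functionI) (intro smooth_on_add chart_open smooth_functionD)

lemma smooth_function_mult:
  "smooth_function M f \<Longrightarrow> smooth_function M g \<Longrightarrow> smooth_function M (\<lambda>q. f q * g q)"
  by (rule smooth_functionI)
     (intro smooth_on_bounded_bilinear[OF _ bounded_bilinear_mult] chart_open smooth_functionD)

lemma smooth_function_cmult: "smooth_function M f \<Longrightarrow> smooth_function M (\<lambda>q. k * f q)"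
  by (intro smooth_function_mult smooth_function_const)

lemma smooth_function_diff:
  "smooth_function M f \<Longrightarrow> smooth_function M g \<Longrightarrow> smooth_function M (\<lambda>q. f q - g q)"
  unfolding diff_conv_add_uminus
  by (subst mult_minus1[symmetric]) (intro smooth_function_add smooth_function_cmult)

lemma smooth_function_sum:
  assumes "\<And>i. i \<in> I \<Longrightarrow> smooth_function M (f i)"
  shows "smooth_function M (\<lambda>q. \<Sum>i\<in>I. f i q)"
  using assms
proof (induction I rule: infinite_finite_induct)
  case (insert i I)
  have "smooth_function M (\<lambda>q. f i q + (\<Sum>j\<in>I. f j q))"
    by (rule smooth_function_add) (use insert in auto)
  then show ?case using insert by simp
qed (simp_all add: smooth_function_const)

lemma smooth_function_compose:
  fixes h :: "real \<Rightarrow> real"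
  assumes "smooth_on UNIV h" "smooth_function M f"
  shows "smooth_function M (\<lambda>q. h (f q))"
  by (rule smooth_functionI)
     (rule smooth_on_compose[OF chart_open open_UNIV subset_UNIV assms(1) smooth_functionD[OF assms(2)]])

section \<open>Calculus of derivations at a point\<close>

context
  fixes p v
  assumes v: "v \<in> tangent_space M p"
begin

lemma tangent_add: "smooth_function M f \<Longrightarrow> smooth_function M g \<Longrightarrow> v (\<lambda>q. f q + g q) = v f + v g"
  and tangent_mult: "smooth_function M f \<Longrightarrow> smooth_function M g \<Longrightarrow> v (\<lambda>q. f q * g q) = f p * v g + g p * v f"
  and tangent_cmult: "smooth_function M f \<Longrightarrow> v (\<lambda>q. k * f q) = k * v f"
  and tangent_not_smooth: "\<not> smooth_function M f \<Longrightarrow> v f = 0"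
proof -
  from v have A: "\<forall>f f'. smooth_function M f \<longrightarrow> smooth_function M f' \<longrightarrow>
      v (\<lambda>q. f q + f' q) = v f + v f' \<and> v (\<lambda>q. f q * f' q) = f p * v f' + f' p * v f"
    unfolding tangent_space_def mem_Collect_eq by (elim conjE)
  from v have B: "\<forall>c f. smooth_function M f \<longrightarrow> v (\<lambda>q. c * f q) = c * v f"
    unfolding tangent_space_def mem_Collect_eq by (elim conjE)
  from v have C: "\<forall>f. \<not> smooth_function M f \<longrightarrow> v f = 0"
    unfolding tangent_space_def mem_Collect_eq by (elim conjE)
  show "v (\<lambda>q. f q + g q) = v f + v g" if "smooth_function M f" "smooth_function M g"
    using A[rule_format, OF that] by (rule conjunct1)
  show "v (\<lambda>q. f q * g q) = f p * v g + g p * v f" if "smooth_function M f" "smooth_function M g"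
    using A[rule_format, OF that] by (rule conjunct2)
  show "v (\<lambda>q. k * f q) = k * v f" if "smooth_function M f" using that by (rule B[rule_format])
  show "v f = 0" if "\<not> smooth_function M f" using that by (rule C[rule_format])
qed

lemma tangent_diff: "smooth_function M f \<Longrightarrow> smooth_function M g \<Longrightarrow> v (\<lambda>q. f q - g q) = v f - v g"
  using tangent_add[OF _ smooth_function_cmult[of g "-1"], of f] tangent_cmult[of g "-1"] by simp

text \<open>The product rule for 1 = 1 * 1 gives v(1) = 2 v(1).\<close>

lemma tangent_const: "v (\<lambda>q. k) = 0"
proof -
  have "v (\<lambda>q. 1) = 0"
    using tangent_mult[OF smooth_function_const[of 1] smooth_function_const[of 1]] by simp
  then show ?thesis using tangent_cmult[OF smooth_function_const[of 1], of k] by simp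
qed

lemma tangent_sum:
  "(\<And>i. i \<in> I \<Longrightarrow> smooth_function M (f i)) \<Longrightarrow> v (\<lambda>q. \<Sum>i\<in>I. f i q) = (\<Sum>i\<in>I. v (f i))"
proof (induction I rule: infinite_finite_induct)
  case (insert i I)
  then have "v (\<lambda>q. f i q + (\<Sum>j\<in>I. f j q)) = v (f i) + v (\<lambda>q. \<Sum>j\<in>I. f j q)"
    by (intro tangent_add smooth_function_sum) auto
  then show ?case using insert by simp
qed (simp_all add: tangent_const)

text \<open>Hadamard's expansion of \<open>h\<close> at \<open>f p\<close> is a constant plus a
  product whose factor \<open>f q - f p\<close> vanishes at \<open>p\<close>, so the product rule
  leaves a single term. The case of interest is the exponential in the conformal factor.\<close>

lemma tangent_compose:
  fixes h :: "real \<Rightarrow> real"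
  assumes h: "smooth_on UNIV h" and f: "smooth_function M f"
  shows "v (\<lambda>q. h (f q)) = frechet_derivative h (at (f p)) 1 * v f"
proof -
  obtain k where k: "smooth_on UNIV k" "k (f p) = frechet_derivative h (at (f p)) 1"
    and h_eq: "\<And>t. h t = h (f p) + (t - f p) * k t"
    using smooth_on_Hadamard[OF open_UNIV convex_UNIV h UNIV_I, of "f p"] by auto
  have s: "smooth_function M (\<lambda>q. f q - f p)" "smooth_function M (\<lambda>q. k (f q))"
    by (intro smooth_function_diff f smooth_function_const) (rule smooth_function_compose[OF k(1) f])
  have "v (\<lambda>q. h (f q)) = v (\<lambda>q. h (f p) + (f q - f p) * k (f q))"
    by (subst h_eq) simp
  also have "\<dots> = v (\<lambda>q. (f q - f p) * k (f q))"
    by (subst tangent_add[OF smooth_function_const smooth_function_mult[OF s]]) (simp add: tangent_const)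
  also have "\<dots> = k (f p) * v (\<lambda>q. f q - f p)"
    by (subst tangent_mult[OF s]) simp
  also have "v (\<lambda>q. f q - f p) = v f"
    by (subst tangent_diff[OF f smooth_function_const]) (simp add: tangent_const)
  finally show ?thesis by (simp only: k(2))
qed

end

lemma tangent_spaceI:
  assumes "\<And>f g. smooth_function M f \<Longrightarrow> smooth_function M g \<Longrightarrow> v (\<lambda>q. f q + g q) = v f + v g"
    and "\<And>f g. smooth_function M f \<Longrightarrow> smooth_function M g \<Longrightarrow> v (\<lambda>q. f q * g q) = f p * v g + g p * v f"
    and "\<And>k f. smooth_function M f \<Longrightarrow> v (\<lambda>q. k * f q) = k * v f"
    and "\<And>f. \<not> smooth_function M f \<Longrightarrow> v f = 0"
  shows "v \<in> tangent_space M p"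
  unfolding tangent_space_def mem_Collect_eq by (intro conjI allI impI assms)

lemma subspace_tangent_space: "subspace (tangent_space M p)"
  unfolding subspace_def
  by (intro conjI ballI allI tangent_spaceI)
     (simp_all add: tangent_add tangent_mult tangent_cmult tangent_not_smooth algebra_simps)

section \<open>Vector fields as a module over the smooth functions\<close>

lemma vector_fields_tangent: "X \<in> vector_fields M \<Longrightarrow> q \<in> points M \<Longrightarrow> X q \<in> tangent_space M q"
  and vector_fields_outside: "X \<in> vector_fields M \<Longrightarrow> q \<notin> points M \<Longrightarrow> X q = 0"
  and vector_fields_smooth: "X \<in> vector_fields M \<Longrightarrow> smooth_function M f \<Longrightarrow> smooth_function M (derivative_along X f)"
proof -
  show "X q \<in> tangent_space M q" if "X \<in> vector_fields M" "q \<in> points M"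
    using that unfolding vector_fields_def mem_Collect_eq by (elim conjE) (erule bspec)
  show "X q = 0" if "X \<in> vector_fields M" "q \<notin> points M"
    using that unfolding vector_fields_def mem_Collect_eq by (elim conjE) (erule allE, erule mp)
  show "smooth_function M (derivative_along X f)" if "X \<in> vector_fields M" "smooth_function M f"
    using that unfolding vector_fields_def mem_Collect_eq by (elim conjE) (erule allE, erule mp)
qed

lemma vector_fieldsI:
  assumes "\<And>q. q \<in> points M \<Longrightarrow> X q \<in> tangent_space M q" "\<And>q f. q \<notin> points M \<Longrightarrow> X q f = 0"
    and "\<And>f. smooth_function M f \<Longrightarrow> smooth_function M (\<lambda>q. X q f)"
  shows "X \<in> vector_fields M"
  unfolding vector_fields_def mem_Collect_eq derivative_along_def
  by (intro conjI allI ballI impI ext assms) (simp_all add: assms(2))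

lemma vector_fields_smooth':
  "X \<in> vector_fields M \<Longrightarrow> smooth_function M f \<Longrightarrow> smooth_function M (\<lambda>q. X q f)"
  using vector_fields_smooth unfolding derivative_along_def .

lemma vector_fields_zero: "0 \<in> vector_fields M"
  by (intro vector_fieldsI)
     (simp_all add: subspace_0[OF subspace_tangent_space] smooth_function_const)

lemma vector_fields_add: "X \<in> vector_fields M \<Longrightarrow> Y \<in> vector_fields M \<Longrightarrow> X + Y \<in> vector_fields M"
  by (intro vector_fieldsI)
     (simp_all add: subspace_add[OF subspace_tangent_space] vector_fields_tangent vector_fields_outside
       smooth_function_add vector_fields_smooth')

lemma vector_fields_scale:
  "smooth_function M f \<Longrightarrow> X \<in> vector_fields M \<Longrightarrow> field_scale f X \<in> vector_fields M"
  unfolding field_scale_def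
  by (intro vector_fieldsI)
     (simp_all add: subspace_scale[OF subspace_tangent_space] vector_fields_tangent vector_fields_outside
       smooth_function_mult vector_fields_smooth')

lemma vector_fields_diff:
  assumes "X \<in> vector_fields M" "Y \<in> vector_fields M"
  shows "X - Y \<in> vector_fields M"
proof -
  have "X - Y = X + field_scale (\<lambda>q. -1) Y" by (simp add: field_scale_def fun_eq_iff)
  then show ?thesis
    using assms by (metis vector_fields_add vector_fields_scale smooth_function_const)
qed

end

section \<open>Cut-off coordinate fields\<close>

text \<open>Bumps will be supported in the closed ball of radius \<open>r\<close>. The factor 2
  leaves a larger open ball in the chart on which the local formula is valid and which overlaps the
  region where the bump vanishes.\<close>

locale bump_chart = manifold M for M :: "('a, 'e::euclidean_space) atlas_space" +
  fixes U :: "'a set" and c :: "'a \<Rightarrow> 'e" and a :: 'e and r :: real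
  assumes chart: "(U, c) \<in> atlas M" and r: "0 < r" and ball: "ball a (2 * r) \<subseteq> c ` U"
begin

text \<open>The profile is exp(-1/(r^2 - |x - a|^2)) inside radius \<open>r\<close> and 0 beyond.
  The factor \<open>k\<close> is left free so that one smoothness proof serves the cutoff, the
  coordinates and the frame fields.\<close>

definition bump :: "('e \<Rightarrow> real) \<Rightarrow> 'a \<Rightarrow> real" where
  "bump k q = (if q \<in> U \<and> c q \<in> ball a (2 * r)
     then flat 0 (r\<^sup>2 - (c q - a) \<bullet> (c q - a)) * k (c q) else 0)"

lemma inv_c: "q \<in> U \<Longrightarrow> inv_into U c (c q) = q"
  by (rule inv_into_f_f[OF chart_inj_on[OF chart]])

lemma smooth_on_flat_profile: "smooth_on UNIV (\<lambda>x. flat 0 (r\<^sup>2 - (x - a) \<bullet> (x - a)))"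
proof -
  have d: "smooth_on UNIV (\<lambda>x. x - a)"
    unfolding diff_conv_add_uminus
    by (intro smooth_on_add smooth_on_const smooth_on_bounded_linear bounded_linear_ident open_UNIV)
  have "smooth_on UNIV (\<lambda>x. r\<^sup>2 + (-1) * ((x - a) \<bullet> (x - a)))"
    by (intro smooth_on_add smooth_on_const smooth_on_bounded_bilinear[OF _ bounded_bilinear_mult]
        smooth_on_bounded_bilinear[OF _ bounded_bilinear_inner d d] open_UNIV)
  then have "smooth_on UNIV (\<lambda>x. r\<^sup>2 - (x - a) \<bullet> (x - a))" by simp
  moreover have "smooth_on UNIV (flat 0)" unfolding smooth_on_def by (simp add: Ck_on_flat)
  ultimately show ?thesis by (rule smooth_on_compose[OF open_UNIV open_UNIV subset_UNIV, rotated])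
qed

text \<open>The manifold is covered by two open sets: the preimage \<open>W\<close> of the large
  ball, where the formula is smooth after a change of charts, and the complement of the compact set
  \<open>K\<close>, where the bump is zero.\<close>

lemma smooth_function_bump:
  assumes k: "smooth_on (ball a (2 * r)) k"
  shows "smooth_function M (bump k)"
proof (rule smooth_functionI)
  fix U' c' assume U': "(U', c') \<in> atlas M"
  define K where "K = {q \<in> U. c q \<in> cball a r}"
  define W where "W = {q \<in> U. c q \<in> ball a (2 * r)}"
  let ?S1 = "c' ` (U' \<inter> W)" and ?S2 = "c' ` (U' \<inter> (points M - K))"
  have sub: "cball a r \<subseteq> ball a (2 * r)" using r by auto
  have "openin (topology_of M) W" unfolding W_def by (rule chart_openin_preimage[OF chart open_ball])
  then have S1: "open ?S1" by (rule chart_open_image[OF U'])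
  have "closedin (topology_of M) K" unfolding K_def
    by (rule chart_closedin_preimage[OF chart compact_cball]) (use ball sub in blast)
  then have "openin (topology_of M) (points M - K)" unfolding points_def by (rule openin_diff[OF openin_topspace])
  then have S2: "open ?S2" by (rule chart_open_image[OF U'])
  have inv': "inv_into U' c' (c' q) = q" if "q \<in> U'" for q
    using that by (rule inv_into_f_f[OF chart_inj_on[OF U']])
  let ?T = "\<lambda>x. c (inv_into U' c' x)"
  have "smooth_on (c' ` (U' \<inter> U)) ?T"
    using chart_transition[OF U' chart] unfolding comp_def .
  then have T: "smooth_on ?S1 ?T" by (rule smooth_on_subset) (auto simp: W_def)
  have T_ball: "?T ` ?S1 \<subseteq> ball a (2 * r)" using inv' by (auto simp: W_def)
  have "smooth_on ?S1 (\<lambda>x. flat 0 (r\<^sup>2 - (?T x - a) \<bullet> (?T x - a)))"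
    by (rule smooth_on_compose[OF S1 open_UNIV subset_UNIV smooth_on_flat_profile T])
  moreover have "smooth_on ?S1 (\<lambda>x. k (?T x))"
    by (rule smooth_on_compose[OF S1 open_ball T_ball k T])
  ultimately have "smooth_on ?S1 (\<lambda>x. flat 0 (r\<^sup>2 - (?T x - a) \<bullet> (?T x - a)) * k (?T x))"
    by (rule smooth_on_bounded_bilinear[OF S1 bounded_bilinear_mult])
  then have "smooth_on ?S1 (\<lambda>x. bump k (inv_into U' c' x))"
    by (rule smooth_on_cong[OF S1, rotated]) (auto simp: bump_def W_def inv')
  moreover have "smooth_on ?S2 (\<lambda>x. bump k (inv_into U' c' x))"
  proof (rule smooth_on_cong[OF S2 _ smooth_on_const[OF S2, of 0]])
    fix x assume "x \<in> ?S2"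
    then obtain q where q: "x = c' q" "q \<in> U'" "q \<notin> K" by auto
    have "r\<^sup>2 \<le> (c q - a) \<bullet> (c q - a)" if "q \<in> U"
    proof -
      have "r < norm (c q - a)" using q(3) that by (auto simp: K_def dist_norm norm_minus_commute)
      then show ?thesis using r by (simp add: dot_square_norm power_mono)
    qed
    then show "0 = bump k (inv_into U' c' x)" using q by (simp add: inv' bump_def flat_nonpos)
  qed
  ultimately have "smooth_on (?S1 \<union> ?S2) (\<lambda>x. bump k (inv_into U' c' x))"
    by (rule smooth_on_Un[OF S1 S2])
  moreover have "K \<subseteq> W" using sub by (auto simp: W_def K_def)
  then have "U' \<inter> W \<union> U' \<inter> (points M - K) = U'" using chart_subset[OF U'] by blast
  then have "?S1 \<union> ?S2 = c' ` U'" by (metis image_Un)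
  ultimately show "smooth_on (c' ` U') (\<lambda>x. bump k (inv_into U' c' x))" by simp
qed

text \<open>\<open>cutoff\<close> need not be constant near any point: it is only used where it does not vanish.\<close>

definition cutoff :: "'a \<Rightarrow> real" where "cutoff = bump (\<lambda>x. 1)"
definition coordinate :: "'e \<Rightarrow> 'a \<Rightarrow> real" where "coordinate b = bump (\<lambda>x. (x - a) \<bullet> b)"
text \<open>Multiplying the coordinate derivative by the cutoff makes it a field on all of
  \<open>M\<close>. The value 0 on functions that are not smooth is the convention built into
  \<open>tangent_space\<close>.\<close>

definition frame :: "'e \<Rightarrow> 'a vector_field" where
  "frame b q f = (if smooth_function M f
     then bump (\<lambda>x. frechet_derivative (\<lambda>x. f (inv_into U c x)) (at x) b) q else 0)"

lemma smooth_cutoff: "smooth_function M cutoff"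
  unfolding cutoff_def by (intro smooth_function_bump smooth_on_const open_ball)

lemma smooth_coordinate: "smooth_function M (coordinate b)"
  unfolding coordinate_def
proof (rule smooth_function_bump)
  have "smooth_on (ball a (2 * r)) (\<lambda>x. x \<bullet> b + - (a \<bullet> b))"
    by (intro smooth_on_add smooth_on_const smooth_on_bounded_linear bounded_linear_inner_left open_ball)
  then show "smooth_on (ball a (2 * r)) (\<lambda>x. (x - a) \<bullet> b)" by (simp add: inner_diff_left)
qed

lemma smooth_on_ball: "smooth_function M f \<Longrightarrow> smooth_on (ball a (2 * r)) (\<lambda>x. f (inv_into U c x))"
  using smooth_functionD[OF _ chart] ball by (rule smooth_on_subset)

lemma has_derivative_chart:
  assumes "smooth_function M f" "q \<in> U" "c q \<in> ball a (2 * r)"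
  shows "((\<lambda>x. f (inv_into U c x)) has_derivative
    frechet_derivative (\<lambda>x. f (inv_into U c x)) (at (c q))) (at (c q))"
  using smooth_on_ball[OF assms(1)] assms(3) by (rule smooth_on_has_derivative)

lemma frame_tangent: "frame b q \<in> tangent_space M q"
proof (cases "q \<in> U \<and> c q \<in> ball a (2 * r)")
  case True
  let ?D = "\<lambda>f. frechet_derivative (\<lambda>x. f (inv_into U c x)) (at (c q))"
  have D: "frame b q f = flat 0 (r\<^sup>2 - (c q - a) \<bullet> (c q - a)) * ?D f b" if "smooth_function M f" for f
    using that True by (simp add: frame_def bump_def)
  have d: "((\<lambda>x. f (inv_into U c x)) has_derivative ?D f) (at (c q))" if "smooth_function M f" for f
    using has_derivative_chart[OF that] True by simp
  show ?thesis
  proof (rule tangent_spaceI)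
    fix f g assume fg: "smooth_function M f" "smooth_function M g"
    have "?D (\<lambda>q. f q + g q) = (\<lambda>v. ?D f v + ?D g v)"
      by (rule frechet_derivative_at[OF has_derivative_add[OF fg[THEN d]], symmetric])
    then show "frame b q (\<lambda>q. f q + g q) = frame b q f + frame b q g"
      using fg by (simp add: D smooth_function_add algebra_simps)
    have "?D (\<lambda>q. f q * g q) = (\<lambda>v. f (inv_into U c (c q)) * ?D g v + ?D f v * g (inv_into U c (c q)))"
      by (rule frechet_derivative_at[OF has_derivative_mult[OF fg[THEN d]], symmetric])
    then show "frame b q (\<lambda>q. f q * g q) = f q * frame b q g + g q * frame b q f"
      using fg True by (simp add: D smooth_function_mult inv_c algebra_simps)
  next
    fix k f assume f: "smooth_function M f"
    have "?D (\<lambda>q. k * f q) = (\<lambda>v. k * ?D f v)"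
      by (rule frechet_derivative_at[OF has_derivative_mult_right[OF d[OF f]], symmetric])
    then show "frame b q (\<lambda>q. k * f q) = k * frame b q f"
      using f by (simp add: D smooth_function_cmult algebra_simps)
  qed (simp add: frame_def)
next
  case False
  then have "frame b q f = 0" for f by (auto simp: frame_def bump_def)
  then show ?thesis by (intro tangent_spaceI) simp_all
qed

lemma frame_vector_field: "frame b \<in> vector_fields M"
proof (rule vector_fieldsI[OF frame_tangent])
  show "frame b q f = 0" if "q \<notin> points M" for q f
    using that chart_subset[OF chart] by (auto simp: frame_def bump_def)
  show "smooth_function M (\<lambda>q. frame b q f)" if "smooth_function M f" for f
    unfolding frame_def using that
    by (simp add: smooth_function_bump[OF smooth_on_frechet_derivative[OF smooth_on_ball[OF that]]])
qed

lemma bump_eq_cutoff: "bump k q = cutoff q * k (c q)"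
  by (simp add: cutoff_def bump_def)

lemma cutoff_nonzeroD: "cutoff q \<noteq> 0 \<Longrightarrow> q \<in> U \<and> c q \<in> ball a (2 * r)"
  by (auto simp: cutoff_def bump_def split: if_splits)

text \<open>Apply \<open>v\<close> to Hadamard's expansion of \<open>f\<close> at \<open>q\<close>, multiplied by the square of the cutoff.\<close>

lemma frame_expansion:
  assumes v: "v \<in> tangent_space M q"
  shows "cutoff q ^ 3 * v f
    = (\<Sum>b\<in>Basis. (cutoff q * v (coordinate b) - coordinate b q * v cutoff) * frame b q f)"
proof (cases "smooth_function M f \<and> cutoff q \<noteq> 0")
  case False
  then consider "\<not> smooth_function M f" | "cutoff q = 0" by blast
  then show ?thesis
    by cases (simp_all add: frame_def coordinate_def tangent_not_smooth[OF v] bump_eq_cutoff)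
next
  case True
  then have f: "smooth_function M f" and q0: "cutoff q \<noteq> 0" by auto
  have q: "q \<in> U" "c q \<in> ball a (2 * r)" using cutoff_nonzeroD[OF q0] by auto
  obtain g where g: "\<And>b. smooth_on (ball a (2 * r)) (g b)"
    and expansion: "\<And>x. x \<in> ball a (2 * r) \<Longrightarrow> f (inv_into U c x)
      = f (inv_into U c (c q)) + (\<Sum>b\<in>Basis. ((x - c q) \<bullet> b) * g b x)"
    and g0: "\<And>b. g b (c q) = frechet_derivative (\<lambda>x. f (inv_into U c x)) (at (c q)) b"
    using smooth_on_Hadamard[OF open_ball convex_ball smooth_on_ball[OF f] q(2)] by blast
  let ?k = "\<lambda>b. (c q - a) \<bullet> b"
  \<comment> \<open>These are the cut-off coordinates recentred at \<open>q\<close>. They vanish at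
    \<open>q\<close>, so the product rule never differentiates the factor
    \<open>bump (g b)\<close>.\<close>
  define w where "w b q' = coordinate b q' - ?k b * cutoff q'" for b q'
  have w: "smooth_function M (w b)" for b
    unfolding w_def by (intro smooth_function_diff smooth_coordinate smooth_function_cmult smooth_cutoff)
  have G: "smooth_function M (bump (g b))" for b by (rule smooth_function_bump[OF g])
  have wq: "w b q = 0" for b
    by (simp add: w_def coordinate_def bump_eq_cutoff)
  have sq: "smooth_function M (\<lambda>q'. cutoff q' * cutoff q')"
    by (intro smooth_function_mult smooth_cutoff)
  \<comment> \<open>Both \<open>w b\<close> and \<open>bump (g b)\<close> carry one factor of the
    cutoff, hence its square on the left. Outside the chart all terms vanish.\<close>
  have product: "(\<lambda>q'. cutoff q' * cutoff q' * f q')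
      = (\<lambda>q'. f q * (cutoff q' * cutoff q') + (\<Sum>b\<in>Basis. w b q' * bump (g b) q'))"
  proof
    fix q'
    show "cutoff q' * cutoff q' * f q'
      = f q * (cutoff q' * cutoff q') + (\<Sum>b\<in>Basis. w b q' * bump (g b) q')"
    proof (cases "cutoff q' = 0")
      case True
      then show ?thesis by (simp add: bump_eq_cutoff)
    next
      case False
      then have q': "q' \<in> U" "c q' \<in> ball a (2 * r)" using cutoff_nonzeroD by auto
      have "w b q' * bump (g b) q' = cutoff q' * cutoff q' * (((c q' - c q) \<bullet> b) * g b (c q'))" for b
        by (simp add: w_def coordinate_def bump_eq_cutoff inner_diff_left algebra_simps)
      then have "(\<Sum>b\<in>Basis. w b q' * bump (g b) q')
          = cutoff q' * cutoff q' * (\<Sum>b\<in>Basis. ((c q' - c q) \<bullet> b) * g b (c q'))"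
        by (simp add: sum_distrib_left)
      moreover have "f q' = f q + (\<Sum>b\<in>Basis. ((c q' - c q) \<bullet> b) * g b (c q'))"
        using expansion[OF q'(2)] q'(1) q(1) by (simp add: inv_c)
      ultimately show ?thesis by (simp add: algebra_simps)
    qed
  qed
  have "v (\<lambda>q'. cutoff q' * cutoff q' * f q')
      = f q * v (\<lambda>q'. cutoff q' * cutoff q') + (\<Sum>b\<in>Basis. v (\<lambda>q'. w b q' * bump (g b) q'))"
    unfolding product
    by (subst tangent_add[OF v smooth_function_cmult[OF sq] smooth_function_sum[OF smooth_function_mult[OF w G]]],
        subst tangent_cmult[OF v sq], subst tangent_sum[OF v smooth_function_mult[OF w G]]) simp
  moreover have "v (\<lambda>q'. cutoff q' * cutoff q' * f q')
      = cutoff q * cutoff q * v f + f q * v (\<lambda>q'. cutoff q' * cutoff q')"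
    by (rule tangent_mult[OF v sq f])
  moreover have "v (\<lambda>q'. w b q' * bump (g b) q') = bump (g b) q * v (w b)" for b
    using tangent_mult[OF v w G, of b b] wq by simp
  moreover have "v (w b) = v (coordinate b) - ?k b * v cutoff" for b
    unfolding w_def
    by (simp add: tangent_diff[OF v smooth_coordinate smooth_function_cmult[OF smooth_cutoff]]
        tangent_cmult[OF v smooth_cutoff])
  ultimately have "cutoff q * cutoff q * v f
      = (\<Sum>b\<in>Basis. bump (g b) q * (v (coordinate b) - ?k b * v cutoff))" by simp
  \<comment> \<open>The third factor turns \<open>?k b\<close>, which makes sense only in the chart,
    into the globally smooth \<open>coordinate b q\<close>. The coefficients are then smooth
    functions on \<open>M\<close> when \<open>q\<close> varies.\<close>
  then have "cutoff q * (cutoff q * cutoff q * v f)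
      = (\<Sum>b\<in>Basis. cutoff q * (bump (g b) q * (v (coordinate b) - ?k b * v cutoff)))"
    by (simp add: sum_distrib_left)
  also have "\<dots> = (\<Sum>b\<in>Basis. (cutoff q * v (coordinate b) - coordinate b q * v cutoff) * frame b q f)"
    using f by (intro sum.cong refl)
      (simp add: frame_def coordinate_def bump_eq_cutoff[of "g _"] bump_eq_cutoff g0 algebra_simps)
  finally show ?thesis by (simp add: power3_eq_cube algebra_simps)
qed

lemma cutoff_center: "p \<in> U \<Longrightarrow> c p = a \<Longrightarrow> 0 < cutoff p"
  unfolding cutoff_def bump_def using flat_pos[of "r\<^sup>2" 0] r by simp

text \<open>The centred coordinate vanishes at \<open>a\<close>, so the derivative of the cutoff
  drops out; one factor of the cutoff comes from the frame and one from the coordinate. Up to this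
  scalar the cut-off coordinates are dual to the frame at the centre.\<close>

lemma frame_coordinate_center:
  assumes "p \<in> U" "c p = a"
  shows "frame b p (coordinate b') = (cutoff p)\<^sup>2 * (b \<bullet> b')"
proof -
  let ?\<chi> = "\<lambda>x. flat 0 (r\<^sup>2 - (x - a) \<bullet> (x - a))"
  have "((\<lambda>x. ?\<chi> x * ((x - a) \<bullet> b')) has_derivative
      (\<lambda>v. ?\<chi> a * (v \<bullet> b') + frechet_derivative ?\<chi> (at a) v * ((a - a) \<bullet> b'))) (at a)"
  proof (rule has_derivative_mult)
    show "(?\<chi> has_derivative frechet_derivative ?\<chi> (at a)) (at a)"
      by (rule smooth_on_has_derivative[OF smooth_on_flat_profile UNIV_I])
    show "((\<lambda>x. (x - a) \<bullet> b') has_derivative (\<lambda>v. v \<bullet> b')) (at a)"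
      using bounded_linear.has_derivative[OF bounded_linear_inner_left
          has_derivative_diff[OF has_derivative_ident has_derivative_const]] by simp
  qed
  then have "((\<lambda>x. coordinate b' (inv_into U c x)) has_derivative
      (\<lambda>v. ?\<chi> a * (v \<bullet> b') + frechet_derivative ?\<chi> (at a) v * ((a - a) \<bullet> b'))) (at a)"
  proof (rule has_derivative_transform_within_open[OF _ open_ball[of a "2 * r"]])
    show "a \<in> ball a (2 * r)" using r by simp
    fix x assume x: "x \<in> ball a (2 * r)"
    then have "x \<in> c ` U" using ball by blast
    then have "inv_into U c x \<in> U" "c (inv_into U c x) = x"
      by (rule inv_into_into, rule f_inv_into_f)
    with x show "?\<chi> x * ((x - a) \<bullet> b') = coordinate b' (inv_into U c x)"
      by (simp add: coordinate_def bump_def)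
  qed
  from frechet_derivative_at[OF this, THEN fun_cong, of b]
  have "frechet_derivative (\<lambda>x. coordinate b' (inv_into U c x)) (at a) b = ?\<chi> a * (b \<bullet> b')"
    by simp
  moreover have "cutoff p = ?\<chi> a" using assms r by (simp add: cutoff_def bump_def)
  moreover have "frame b p (coordinate b')
      = cutoff p * frechet_derivative (\<lambda>x. coordinate b' (inv_into U c x)) (at (c p)) b"
    unfolding frame_def by (simp only: smooth_coordinate if_True) (rule bump_eq_cutoff)
  ultimately show ?thesis by (simp only: assms(2) power2_eq_square mult.assoc)
qed

end

section \<open>Weyl curvature tensors\<close>

lemma linear_form_on_diff:
  assumes "subspace V" "linear_form_on V f" "x \<in> V" "y \<in> V"
  shows "f (x - y) = f x - f y"
proof -
  have "f (x + (-1) *\<^sub>R y) = f x + f ((-1) *\<^sub>R y)" "f ((-1) *\<^sub>R y) = -1 * f y"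
    using assms subspace_scale[OF assms(1,4)] unfolding linear_form_on_def by blast+
  then show ?thesis by simp
qed

lemma inner_product_on_nondegenerate:
  assumes V: "subspace V" and h: "inner_product_on V h" and uv: "u \<in> V" "v \<in> V"
    and eq: "\<And>w. w \<in> V \<Longrightarrow> h u w = h v w"
  shows "u = v"
proof -
  have "h (u - v) w = 0" if "w \<in> V" for w
    using linear_form_on_diff[OF V _ uv, of "\<lambda>x. h x w"] h eq[OF that] that
    unfolding inner_product_on_def bilinear_form_on_def by auto
  then have "u - v = 0"
    using h subspace_diff[OF V uv] unfolding inner_product_on_def by blast
  then show ?thesis by simp
qed

text \<open>The hypothesis is the Bianchi identity for \<open>F \<otimes> h\<close>; the conclusion forces \<open>F x y = 0\<close> as
  soon as \<open>z\<close> is independent of \<open>x\<close> and \<open>y\<close>.\<close>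

lemma cyclic_sum_eq_0:
  assumes V: "subspace V" and h: "inner_product_on V h" and xyz: "x \<in> V" "y \<in> V" "z \<in> V"
    and F: "\<And>w. w \<in> V \<Longrightarrow> F x y * h z w + F y z * h x w + F z x * h y w = (0 :: real)"
  shows "F x y *\<^sub>R z + F y z *\<^sub>R x + F z x *\<^sub>R y = 0"
proof (rule inner_product_on_nondegenerate[OF V h])
  show "F x y *\<^sub>R z + F y z *\<^sub>R x + F z x *\<^sub>R y \<in> V" "0 \<in> V"
    using V xyz by (auto intro: subspace_add subspace_scale subspace_0)
  fix w assume w: "w \<in> V"
  have hw: "linear_form_on V (\<lambda>u. h u w)"
    using h w unfolding inner_product_on_def bilinear_form_on_def by simp
  have lin: "h (u + v) w = h u w + h v w" "h (c *\<^sub>R u) w = c * h u w" if "u \<in> V" "v \<in> V" for u v c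
    using hw that unfolding linear_form_on_def by simp_all
  have "h (F x y *\<^sub>R z + F y z *\<^sub>R x + F z x *\<^sub>R y) w = F x y * h z w + F y z * h x w + F z x * h y w"
    using V xyz by (simp add: lin subspace_add subspace_scale)
  moreover have "h 0 w = 0" using lin(2)[of x x 0] xyz by simp
  ultimately show "h (F x y *\<^sub>R z + F y z *\<^sub>R x + F z x *\<^sub>R y) w = h 0 w" using F[OF w] by simp
qed

lemma weyl_conjugate_bianchi_iff:
  assumes V: "subspace V" and dim: "dim V \<ge> 3" and h: "inner_product_on V h"
    and A: "A \<in> weyl_curvature_tensors V h"
  shows "bianchi_identity_on V (conjugate_tensor A) \<longleftrightarrow> A \<in> algebraic_curvature_tensors V"
proof
  have gen: "A \<in> generalized_curvature_tensors V" and bianchi: "bianchi_identity_on V A"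
    using A unfolding weyl_curvature_tensors_def generalized_curvature_tensors_def by auto
  {
    assume "A \<in> algebraic_curvature_tensors V"
    then have skew: "A x y z w + A x y w z = 0" if "x \<in> V" "y \<in> V" "z \<in> V" "w \<in> V" for x y z w
      using that unfolding algebraic_curvature_tensors_def by blast
    have "conjugate_tensor A x y z w = A x y z w" if "x \<in> V" "y \<in> V" "z \<in> V" "w \<in> V" for x y z w
      using skew[OF that] unfolding conjugate_tensor_def by linarith
    then show "bianchi_identity_on V (conjugate_tensor A)"
      using bianchi unfolding bianchi_identity_on_def by simp
  }
  define F where "F x y = 2 / real (dim V) * (ricci V h A y x - ricci V h A x y)" for x y
  have F: "A x y z w + A x y w z = F x y * h z w" if "x \<in> V" "y \<in> V" "z \<in> V" "w \<in> V" for x y z w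
    using A that unfolding weyl_curvature_tensors_def F_def by blast
  assume conj: "bianchi_identity_on V (conjugate_tensor A)"
  have "F x y = 0" if xy: "x \<in> V" "y \<in> V" for x y
  proof (rule ccontr)
    assume nz: "F x y \<noteq> 0"
    \<comment> \<open>If \<open>F x y\<close> is nonzero, the vector identity can be solved for
      \<open>z\<close>, whatever \<open>z\<close> is.\<close>
    have "z \<in> span {x, y}" if z: "z \<in> V" for z
    proof -
      have "F x y * h z w + F y z * h x w + F z x * h y w = 0" if w: "w \<in> V" for w
      proof -
        have "A x y z w + A y z x w + A z x y w = 0"
          using bianchi xy z w unfolding bianchi_identity_on_def by blast
        \<comment> \<open>Subtracting this from the Bianchi identity pairs each value of
          \<open>A\<close> with the one whose last two arguments are exchanged, which is where
          \<open>F\<close> comes in.\<close>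
        moreover have "- A x y w z - A y z w x - A z x w y = 0"
          using conj xy z w unfolding bianchi_identity_on_def conjugate_tensor_def by fastforce
        ultimately show ?thesis
          using F[OF xy z w] F[OF xy(2) z xy(1) w] F[OF z xy w] by linarith
      qed
      then have "F x y *\<^sub>R z + F y z *\<^sub>R x + F z x *\<^sub>R y = 0"
        by (rule cyclic_sum_eq_0[OF V h xy z])
      moreover have "F x y *\<^sub>R z
          = (F x y *\<^sub>R z + F y z *\<^sub>R x + F z x *\<^sub>R y) - (F y z *\<^sub>R x + F z x *\<^sub>R y)"
        by (simp only: add.assoc add_diff_cancel_right')
      ultimately have "F x y *\<^sub>R z = - (F y z *\<^sub>R x + F z x *\<^sub>R y)"
        by (simp only: diff_0)
      moreover have "- (F y z *\<^sub>R x + F z x *\<^sub>R y) \<in> span {x, y}"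
        by (intro span_neg span_add span_scale span_base) auto
      ultimately have "F x y *\<^sub>R z \<in> span {x, y}" by simp
      from span_scale[OF this, of "inverse (F x y)"] nz show ?thesis by simp
    qed
    then have "V \<subseteq> span {x, y}" by auto
    then have "dim V \<le> card {x, y}" by (intro dim_le_card) auto
    also have "\<dots> \<le> 2" by (simp add: card_insert_if)
    finally show False using dim by simp
  qed
  then have "A x y z w + A x y w z = 0" if "x \<in> V" "y \<in> V" "z \<in> V" "w \<in> V" for x y z w
    using F[OF that] that by simp
  then show "A \<in> algebraic_curvature_tensors V"
    using gen unfolding algebraic_curvature_tensors_def by simp
qed

section \<open>Extension of tangent vectors\<close>

context manifold
begin

lemma bump_chart_exists:
  assumes "p \<in> points M"
  obtains U c r where "bump_chart M U c (c p) r" "p \<in> U"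
proof -
  obtain U c where U: "(U, c) \<in> atlas M" "p \<in> U" using assms by (rule chart_cover)
  then obtain e where e: "0 < e" "ball (c p) e \<subseteq> c ` U"
    using chart_open[OF U(1)] unfolding open_contains_ball by blast
  \<comment> \<open>The radius is halved because the locale asks for the ball of twice its radius to
    lie in the chart.\<close>
  have "bump_chart M U c (c p) (e / 2)"
    by unfold_locales (use U e in auto)
  then show ?thesis using that U(2) by blast
qed

lemma sum_field_apply: "(\<Sum>i\<in>I. F i) q f = (\<Sum>i\<in>I. F i q f)"
  for F :: "'i \<Rightarrow> 'a vector_field"
  by (induction I rule: infinite_finite_induct) simp_all

lemma vector_fields_sum:
  "(\<And>i. i \<in> I \<Longrightarrow> F i \<in> vector_fields M) \<Longrightarrow> (\<Sum>i\<in>I. F i) \<in> vector_fields M"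
  by (induction I rule: infinite_finite_induct) (simp_all add: vector_fields_zero vector_fields_add)

text \<open>\<open>frame_expansion\<close> at \<open>p\<close> expresses \<open>v\<close> through
  the frame at \<open>p\<close>. Its coefficients, divided by the cube of the cutoff and kept
  constant, define a global combination of the frame fields.\<close>

lemma tangent_vector_extends:
  assumes p: "p \<in> points M" and v: "v \<in> tangent_space M p"
  shows "\<exists>X\<in>vector_fields M. X p = v"
proof -
  obtain U c r where bump: "bump_chart M U c (c p) r" and U: "p \<in> U"
    using p by (rule bump_chart_exists)
  interpret bump_chart M U c "c p" r by (rule bump)
  define k where "k b = (cutoff p * v (coordinate b) - coordinate b p * v cutoff) / cutoff p ^ 3" for b
  define X where "X = (\<Sum>b\<in>Basis. field_scale (\<lambda>q. k b) (frame b))"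
  have "X \<in> vector_fields M"
    unfolding X_def by (intro vector_fields_sum vector_fields_scale smooth_function_const frame_vector_field)
  moreover have "X p = v"
  proof
    fix f
    have "cutoff p \<noteq> 0" using cutoff_center[OF U] by simp
    then have "v f = (cutoff p ^ 3 * v f) / cutoff p ^ 3" by simp
    also have "\<dots> = (\<Sum>b\<in>Basis. k b * frame b p f)"
      unfolding frame_expansion[OF v] k_def by (simp add: sum_divide_distrib)
    finally show "X p f = v f" by (simp add: X_def sum_field_apply field_scale_def)
  qed
  ultimately show ?thesis by blast
qed

lemma
  assumes "p \<in> points M" "v \<in> tangent_space M p"
  shows extension_field: "extension_field M p v \<in> vector_fields M"
    and extension_field_apply: "extension_field M p v p = v"
proof -
  have "\<exists>X. X \<in> vector_fields M \<and> X p = v" using tangent_vector_extends[OF assms] by blast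
  from someI_ex[OF this]
  show "extension_field M p v \<in> vector_fields M" "extension_field M p v p = v"
    unfolding extension_field_def by auto
qed

lemma smooth_function_cong:
  assumes "smooth_function M f" "\<And>q. q \<in> points M \<Longrightarrow> f q = g q"
  shows "smooth_function M g"
proof (rule smooth_functionI)
  fix U c assume U: "(U, c) \<in> atlas M"
  have "f (inv_into U c x) = g (inv_into U c x)" if "x \<in> c ` U" for x
    using inv_into_into[OF that] chart_subset[OF U] assms(2) by blast
  then show "smooth_on (c ` U) (\<lambda>x. g (inv_into U c x))"
    by (rule smooth_on_cong[OF chart_open[OF U] _ smooth_functionD[OF assms(1) U]])
qed

lemma tangent_cong:
  assumes v: "v \<in> tangent_space M p" and p: "p \<in> points M"
    and eq: "\<And>q. q \<in> points M \<Longrightarrow> f q = g q"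
  shows "v f = v g"
proof (cases "smooth_function M f")
  case True
  then have g: "smooth_function M g" using eq by (rule smooth_function_cong)
  \<comment> \<open>Smoothness says nothing about values outside \<open>points M\<close>, so \<open>?h\<close> is smooth; \<open>f - g\<close> and
    \<open>?h\<close> both vanish at \<open>p\<close>, and so does every derivation on their product.\<close>
  let ?h = "\<lambda>q. if q \<in> points M then 0 else 1 :: real"
  have h: "smooth_function M ?h"
    by (rule smooth_function_cong[OF smooth_function_const[of 0]]) simp
  have "(\<lambda>q. f q - g q) = (\<lambda>q. (f q - g q) * ?h q)" using eq by auto
  then have "v (\<lambda>q. f q - g q) = v (\<lambda>q. (f q - g q) * ?h q)" by simp
  also have "\<dots> = 0"
    using tangent_mult[OF v smooth_function_diff[OF True g] h] p eq[OF p] by simp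
  finally show ?thesis using tangent_diff[OF v True g] by simp
next
  case False
  then have "\<not> smooth_function M g" using smooth_function_cong[of g f] eq by auto
  with False show ?thesis by (simp add: tangent_not_smooth[OF v])
qed

end

section \<open>Weyl structures\<close>

lemma linear_form_onD:
  assumes "linear_form_on V f" "x \<in> V"
  shows "y \<in> V \<Longrightarrow> f (x + y) = f x + f y" and "f (k *\<^sub>R x) = k * f x"
  using assms unfolding linear_form_on_def by auto

locale weyl_structure = manifold M for M :: "('a, 'e::euclidean_space) atlas_space" +
  fixes g :: "'a metric_tensor" and D :: "'a connection" and \<phi> :: "'a one_form"
  assumes metric: "pseudo_riemannian_metric M g"
    and affine: "affine_connection M D"
    and torsion: "torsion_free M D"
    and one_form: "\<phi> \<in> one_forms M"
    and weyl: "\<lbrakk>X \<in> vector_fields M; Y \<in> vector_fields M; Z \<in> vector_fields M; p \<in> points M\<rbrakk>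
      \<Longrightarrow> covariant_derivative_metric D g X Y Z p = - 2 * \<phi> p (X p) * g p (Y p) (Z p)"
begin

section \<open>Elementary consequences of the Weyl data\<close>

lemma metric_inner: "p \<in> points M \<Longrightarrow> inner_product_on (tangent_space M p) (g p)"
  and metric_smooth: "X \<in> vector_fields M \<Longrightarrow> Y \<in> vector_fields M \<Longrightarrow> smooth_function M (\<lambda>p. g p (X p) (Y p))"
  using metric unfolding pseudo_riemannian_metric_def by simp_all

lemma metric_linear:
  assumes "p \<in> points M" "v \<in> tangent_space M p"
  shows "linear_form_on (tangent_space M p) (\<lambda>u. g p u v)" "linear_form_on (tangent_space M p) (g p v)"
  using metric_inner[OF assms(1)] assms(2) unfolding inner_product_on_def bilinear_form_on_def by simp_all

lemma form_linear: "p \<in> points M \<Longrightarrow> linear_form_on (tangent_space M p) (\<phi> p)"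
  and form_smooth: "X \<in> vector_fields M \<Longrightarrow> smooth_function M (\<lambda>p. \<phi> p (X p))"
  using one_form unfolding one_forms_def by simp_all

lemma connection_field: "X \<in> vector_fields M \<Longrightarrow> Y \<in> vector_fields M \<Longrightarrow> D X Y \<in> vector_fields M"
proof -
  have "\<forall>X\<in>vector_fields M. \<forall>Y\<in>vector_fields M. D X Y \<in> vector_fields M"
    using affine unfolding affine_connection_def by (elim conjE)
  then show "X \<in> vector_fields M \<Longrightarrow> Y \<in> vector_fields M \<Longrightarrow> D X Y \<in> vector_fields M" by blast
qed

lemma connection_add_right:
  "X \<in> vector_fields M \<Longrightarrow> Y \<in> vector_fields M \<Longrightarrow> Z \<in> vector_fields M \<Longrightarrow> D X (Y + Z) = D X Y + D X Z"
proof -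
  have "\<forall>X\<in>vector_fields M. \<forall>Y\<in>vector_fields M. \<forall>Z\<in>vector_fields M. D X (Y + Z) = D X Y + D X Z"
    using affine unfolding affine_connection_def by (elim conjE)
  then show "X \<in> vector_fields M \<Longrightarrow> Y \<in> vector_fields M \<Longrightarrow> Z \<in> vector_fields M \<Longrightarrow> D X (Y + Z) = D X Y + D X Z"
    by blast
qed

lemma connection_diff_right:
  assumes "X \<in> vector_fields M" "Y \<in> vector_fields M" "Z \<in> vector_fields M"
  shows "D X (Y - Z) = D X Y - D X Z"
  using connection_add_right[OF assms(1) vector_fields_diff[OF assms(2,3)] assms(3)] by (simp add: eq_diff_eq)

section \<open>Lie brackets and the first Bianchi identity\<close>

lemma lie_bracket_eq:
  "X \<in> vector_fields M \<Longrightarrow> Y \<in> vector_fields M \<Longrightarrow> lie_bracket M X Y = D X Y - D Y X"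
  using torsion unfolding torsion_free_def by simp

text \<open>Torsion-freeness writes the bracket as a difference of covariant derivatives, and these
  are vector fields already.\<close>

lemma lie_bracket_field:
  "X \<in> vector_fields M \<Longrightarrow> Y \<in> vector_fields M \<Longrightarrow> lie_bracket M X Y \<in> vector_fields M"
  by (simp add: lie_bracket_eq vector_fields_diff connection_field)

lemma lie_bracket_apply:
  "smooth_function M f \<Longrightarrow> lie_bracket M X Y p f = X p (derivative_along Y f) - Y p (derivative_along X f)"
  by (simp add: lie_bracket_def)

text \<open>Each double bracket expands into four threefold derivatives of \<open>f\<close>, and the
  twelve terms cancel in pairs.\<close>

lemma jacobi:
  assumes X: "X \<in> vector_fields M" and Y: "Y \<in> vector_fields M" and Z: "Z \<in> vector_fields M"
    and p: "p \<in> points M"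
  shows "lie_bracket M X (lie_bracket M Y Z) p f + lie_bracket M Y (lie_bracket M Z X) p f
    + lie_bracket M Z (lie_bracket M X Y) p f = 0"
proof (cases "smooth_function M f")
  case True
  have "lie_bracket M X (lie_bracket M Y Z) p f
      = X p (derivative_along Y (derivative_along Z f)) - X p (derivative_along Z (derivative_along Y f))
        - (Y p (derivative_along Z (derivative_along X f)) - Z p (derivative_along Y (derivative_along X f)))"
    if X: "X \<in> vector_fields M" and Y: "Y \<in> vector_fields M" and Z: "Z \<in> vector_fields M" for X Y Z
  proof -
    have "derivative_along (lie_bracket M Y Z) f
        = (\<lambda>q. derivative_along Y (derivative_along Z f) q - derivative_along Z (derivative_along Y f) q)"
      unfolding derivative_along_def lie_bracket_apply[OF True, unfolded derivative_along_def] ..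
    then have "X p (derivative_along (lie_bracket M Y Z) f)
        = X p (derivative_along Y (derivative_along Z f)) - X p (derivative_along Z (derivative_along Y f))"
      by (simp only:) (rule tangent_diff[OF vector_fields_tangent[OF X p]
          vector_fields_smooth[OF Y vector_fields_smooth[OF Z True]]
          vector_fields_smooth[OF Z vector_fields_smooth[OF Y True]], folded derivative_along_def])
    moreover have "lie_bracket M Y Z p (derivative_along X f)
        = Y p (derivative_along Z (derivative_along X f)) - Z p (derivative_along Y (derivative_along X f))"
      by (rule lie_bracket_apply[OF vector_fields_smooth[OF X True]])
    ultimately show ?thesis by (simp only: lie_bracket_apply[OF True])
  qed
  from this[OF X Y Z] this[OF Y Z X] this[OF Z X Y] show ?thesis by simp
qed (simp add: lie_bracket_def)

text \<open>Torsion-freeness turns [X,[Y,Z]] into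
  \<open>D X (D Y Z) - D X (D Z Y) - D (lie_bracket M Y Z) X\<close>. The cyclic sum of these is a
  rearrangement of the cyclic sum of the curvature, and it vanishes by the Jacobi identity.\<close>

lemma curvature_bianchi:
  assumes X: "X \<in> vector_fields M" and Y: "Y \<in> vector_fields M" and Z: "Z \<in> vector_fields M"
    and p: "p \<in> points M"
  shows "curvature_operator M D X Y Z p + curvature_operator M D Y Z X p + curvature_operator M D Z X Y p = 0"
proof
  fix f
  note [simp] = X Y Z connection_field lie_bracket_field
  have "lie_bracket M X (lie_bracket M Y Z) p f
      = D X (D Y Z) p f - D X (D Z Y) p f - D (lie_bracket M Y Z) X p f"
    if "X \<in> vector_fields M" "Y \<in> vector_fields M" "Z \<in> vector_fields M" for X Y Z
  proof -
    have "lie_bracket M X (lie_bracket M Y Z) = D X (D Y Z - D Z Y) - D (lie_bracket M Y Z) X"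
      using that by (subst lie_bracket_eq) (simp_all add: lie_bracket_eq[symmetric])
    then show ?thesis using that by (simp add: connection_diff_right)
  qed
  from this[OF X Y Z] this[OF Y Z X] this[OF Z X Y] jacobi[OF X Y Z p, of f]
  show "(curvature_operator M D X Y Z p + curvature_operator M D Y Z X p + curvature_operator M D Z X Y p) f = 0 f"
    by (simp add: curvature_operator_def)
qed

section \<open>Curvature and the exterior derivative of the Weyl form\<close>

abbreviation ed :: "'a vector_field \<Rightarrow> 'a vector_field \<Rightarrow> 'a \<Rightarrow> real" where
  "ed \<equiv> exterior_derivative M \<phi>"

lemma derivative_metric:
  assumes "X \<in> vector_fields M" "Y \<in> vector_fields M" "Z \<in> vector_fields M" "p \<in> points M"
  shows "X p (\<lambda>q. g q (Y q) (Z q))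
    = g p (D X Y p) (Z p) + g p (Y p) (D X Z p) - 2 * (\<phi> p (X p) * g p (Y p) (Z p))"
  using weyl[OF assms] unfolding covariant_derivative_metric_def derivative_along_def by simp

text \<open>Written so that the symmetry in \<open>X\<close> and \<open>Y\<close> is visible: apart
  from the two second covariant derivatives and the last line, all terms are symmetric together and
  cancel in the commutator.\<close>

lemma second_derivative_metric:
  assumes X: "X \<in> vector_fields M" and Y: "Y \<in> vector_fields M"
    and Z: "Z \<in> vector_fields M" and W: "W \<in> vector_fields M" and p: "p \<in> points M"
  defines "G \<equiv> \<lambda>A B q. g q (A q) (B q)"
  shows "X p (derivative_along Y (G Z W))
    = G (D X (D Y Z)) W p + G (D Y Z) (D X W) p + G (D X Z) (D Y W) p + G Z (D X (D Y W)) p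
      - 2 * (\<phi> p (X p) * (G (D Y Z) W p + G Z (D Y W) p))
      - 2 * (\<phi> p (Y p) * (G (D X Z) W p + G Z (D X W) p))
      + 4 * (\<phi> p (X p) * \<phi> p (Y p) * G Z W p)
      - 2 * (G Z W p * X p (\<lambda>q. \<phi> q (Y q)))"
proof -
  have v: "X p \<in> tangent_space M p" using X p by (rule vector_fields_tangent)
  have DY: "D Y Z \<in> vector_fields M" "D Y W \<in> vector_fields M" using Y Z W by (simp_all add: connection_field)
  have smooth: "smooth_function M (G A B)" if "A \<in> vector_fields M" "B \<in> vector_fields M" for A B
    unfolding G_def using that by (rule metric_smooth)
  have G: "X p (G A B) = G (D X A) B p + G A (D X B) p - 2 * (\<phi> p (X p) * G A B p)"
    if "A \<in> vector_fields M" "B \<in> vector_fields M" for A B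
    unfolding G_def using X that p by (rule derivative_metric)
  let ?f = "\<lambda>q. \<phi> q (Y q)"
  have f: "smooth_function M ?f" using Y by (rule form_smooth)
  \<comment> \<open>The Weyl equation is known on \<open>points M\<close> only, while
    \<open>X p\<close> acts on functions on the whole type; \<open>tangent_cong\<close> bridges the
    gap.\<close>
  have "X p (derivative_along Y (G Z W))
      = X p (\<lambda>q. (G (D Y Z) W q + G Z (D Y W) q) - 2 * (?f q * G Z W q))"
    using v p
  proof (rule tangent_cong)
    fix q assume "q \<in> points M"
    from derivative_metric[OF Y Z W this]
    show "derivative_along Y (G Z W) q = (G (D Y Z) W q + G Z (D Y W) q) - 2 * (?f q * G Z W q)"
      unfolding derivative_along_def G_def .
  qed
  also have "\<dots> = X p (\<lambda>q. G (D Y Z) W q + G Z (D Y W) q) - X p (\<lambda>q. 2 * (?f q * G Z W q))"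
    by (rule tangent_diff[OF v smooth_function_add[OF smooth[OF DY(1) W] smooth[OF Z DY(2)]]
        smooth_function_cmult[OF smooth_function_mult[OF f smooth[OF Z W]]]])
  also have "X p (\<lambda>q. G (D Y Z) W q + G Z (D Y W) q) = X p (G (D Y Z) W) + X p (G Z (D Y W))"
    by (rule tangent_add[OF v smooth[OF DY(1) W] smooth[OF Z DY(2)]])
  also have "X p (\<lambda>q. 2 * (?f q * G Z W q)) = 2 * X p (\<lambda>q. ?f q * G Z W q)"
    by (rule tangent_cmult[OF v smooth_function_mult[OF f smooth[OF Z W]]])
  also have "X p (\<lambda>q. ?f q * G Z W q) = ?f p * X p (G Z W) + G Z W p * X p ?f"
    by (rule tangent_mult[OF v f smooth[OF Z W]])
  finally show ?thesis
    unfolding G[OF DY(1) W] G[OF Z DY(2)] G[OF Z W] by (simp add: algebra_simps)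
qed

text \<open>The bracket [X,Y] is applied to g(Z,W) in two ways: as a commutator of second
  derivatives, and by the Weyl equation for the field [X,Y] itself. Comparing them leaves the
  curvature terms on one side and dphi on the other.\<close>

lemma curvature_metric:
  assumes X: "X \<in> vector_fields M" and Y: "Y \<in> vector_fields M"
    and Z: "Z \<in> vector_fields M" and W: "W \<in> vector_fields M" and p: "p \<in> points M"
  shows "g p (curvature_operator M D X Y Z p) (W p) + g p (Z p) (curvature_operator M D X Y W p)
    = 2 * ed X Y p * g p (Z p) (W p)"
proof -
  let ?G = "\<lambda>q. g q (Z q) (W q)"
  let ?L = "lie_bracket M X Y"
  have L: "?L \<in> vector_fields M" using X Y by (rule lie_bracket_field)
  have tan: "A p \<in> tangent_space M p" if "A \<in> vector_fields M" for A
    using that p by (rule vector_fields_tangent)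
  note fields = X Y Z W L connection_field
  have lin: "linear_form_on (tangent_space M p) (\<lambda>u. g p u (W p))" "linear_form_on (tangent_space M p) (g p (Z p))"
    using metric_linear[OF p] tan Z W by auto
  note diff = linear_form_on_diff[OF subspace_tangent_space]
  have R: "f (curvature_operator M D X Y A p) = f (D X (D Y A) p) - f (D Y (D X A) p) - f (D ?L A p)"
    if "linear_form_on (tangent_space M p) f" "A \<in> vector_fields M" for f A
  proof -
    have "D X (D Y A) p \<in> tangent_space M p" "D Y (D X A) p \<in> tangent_space M p" "D ?L A p \<in> tangent_space M p"
      using that fields by (auto intro!: tan)
    then show ?thesis
      unfolding curvature_operator_def
      by (simp add: diff[OF that(1)] subspace_diff[OF subspace_tangent_space])
  qed
  have L_G: "?L p ?G = X p (derivative_along Y ?G) - Y p (derivative_along X ?G)"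
    by (rule lie_bracket_apply[OF metric_smooth[OF Z W]])
  have ed: "ed X Y p = X p (\<lambda>q. \<phi> q (Y q)) - Y p (\<lambda>q. \<phi> q (X q)) - \<phi> p (?L p)"
    unfolding exterior_derivative_def derivative_along_def ..
  show ?thesis
    unfolding ed R[OF lin(1) Z] R[OF lin(2) W]
    using L_G second_derivative_metric[OF X Y Z W p] second_derivative_metric[OF Y X Z W p]
      derivative_metric[OF L Z W p]
    by (simp add: algebra_simps)
qed

section \<open>Tensoriality of the exterior derivative\<close>

lemma ed_antisym:
  assumes X: "X \<in> vector_fields M" and Y: "Y \<in> vector_fields M" and p: "p \<in> points M"
  shows "ed Y X p = - ed X Y p"
proof -
  have "lie_bracket M Y X p = (-1) *\<^sub>R lie_bracket M X Y p"
    by (simp add: lie_bracket_def fun_eq_iff)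
  then have "\<phi> p (lie_bracket M Y X p) = - \<phi> p (lie_bracket M X Y p)"
    using linear_form_onD(2)[OF form_linear[OF p] vector_fields_tangent[OF lie_bracket_field[OF X Y] p], of "-1"]
    by simp
  then show ?thesis by (simp add: exterior_derivative_def)
qed

lemma ed_add:
  assumes X: "X \<in> vector_fields M" and X': "X' \<in> vector_fields M" and Y: "Y \<in> vector_fields M"
    and p: "p \<in> points M"
  shows "ed (X + X') Y p = ed X Y p + ed X' Y p"
proof -
  have v: "Y p \<in> tangent_space M p" using Y p by (rule vector_fields_tangent)
  have "Y p (\<lambda>q. \<phi> q ((X + X') q)) = Y p (\<lambda>q. \<phi> q (X q) + \<phi> q (X' q))"
    using v p
  proof (rule tangent_cong)
    show "\<phi> q ((X + X') q) = \<phi> q (X q) + \<phi> q (X' q)" if "q \<in> points M" for q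
      unfolding plus_fun_apply[of X X' q]
      using X[THEN vector_fields_tangent, OF that] X'[THEN vector_fields_tangent, OF that]
      by (rule linear_form_onD(1)[OF form_linear[OF that]])
  qed
  also have "\<dots> = Y p (\<lambda>q. \<phi> q (X q)) + Y p (\<lambda>q. \<phi> q (X' q))"
    by (rule tangent_add[OF v form_smooth[OF X] form_smooth[OF X']])
  finally have 1: "Y p (\<lambda>q. \<phi> q ((X + X') q)) = Y p (\<lambda>q. \<phi> q (X q)) + Y p (\<lambda>q. \<phi> q (X' q))" .
  have "lie_bracket M (X + X') Y p = lie_bracket M X Y p + lie_bracket M X' Y p"
  proof
    fix f
    show "lie_bracket M (X + X') Y p f = (lie_bracket M X Y p + lie_bracket M X' Y p) f"
    proof (cases "smooth_function M f")
      case True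
      have "Y p (\<lambda>q. X q f + X' q f) = Y p (\<lambda>q. X q f) + Y p (\<lambda>q. X' q f)"
        by (rule tangent_add[OF v X[THEN vector_fields_smooth', OF True] X'[THEN vector_fields_smooth', OF True]])
      then show ?thesis using True by (simp add: lie_bracket_def derivative_along_def)
    qed (simp add: lie_bracket_def)
  qed
  then have "\<phi> p (lie_bracket M (X + X') Y p) = \<phi> p (lie_bracket M X Y p) + \<phi> p (lie_bracket M X' Y p)"
    using lie_bracket_field[OF X Y, THEN vector_fields_tangent, OF p]
      lie_bracket_field[OF X' Y, THEN vector_fields_tangent, OF p]
    by (simp only:) (rule linear_form_onD(1)[OF form_linear[OF p]])
  with 1 show ?thesis
    unfolding exterior_derivative_def derivative_along_def by simp
qed

text \<open>The term phi(X) Y f from the product rule cancels against the one from [fX, Y] = f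
  [X, Y] - (Y f) X.\<close>

lemma ed_scale:
  assumes f: "smooth_function M f" and X: "X \<in> vector_fields M" and Y: "Y \<in> vector_fields M"
    and p: "p \<in> points M"
  shows "ed (field_scale f X) Y p = f p * ed X Y p"
proof -
  have v: "Y p \<in> tangent_space M p" using Y p by (rule vector_fields_tangent)
  have Xp: "X p \<in> tangent_space M p" using X p by (rule vector_fields_tangent)
  note lin = form_linear[OF p]
  have "Y p (\<lambda>q. \<phi> q (field_scale f X q)) = Y p (\<lambda>q. f q * \<phi> q (X q))"
    using v p
  proof (rule tangent_cong)
    show "\<phi> q (field_scale f X q) = f q * \<phi> q (X q)" if "q \<in> points M" for q
      unfolding field_scale_def using X[THEN vector_fields_tangent, OF that]
      by (rule linear_form_onD(2)[OF form_linear[OF that]])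
  qed
  also have "\<dots> = f p * Y p (\<lambda>q. \<phi> q (X q)) + \<phi> p (X p) * Y p f"
    by (rule tangent_mult[OF v f form_smooth[OF X]])
  finally have 1: "Y p (\<lambda>q. \<phi> q (field_scale f X q)) = f p * Y p (\<lambda>q. \<phi> q (X q)) + \<phi> p (X p) * Y p f" .
  have "lie_bracket M (field_scale f X) Y p = f p *\<^sub>R lie_bracket M X Y p + (- Y p f) *\<^sub>R X p"
  proof
    fix k
    show "lie_bracket M (field_scale f X) Y p k = (f p *\<^sub>R lie_bracket M X Y p + (- Y p f) *\<^sub>R X p) k"
    proof (cases "smooth_function M k")
      case True
      have "Y p (\<lambda>q. f q * X q k) = f p * Y p (\<lambda>q. X q k) + X p k * Y p f"
        by (rule tangent_mult[OF v f X[THEN vector_fields_smooth', OF True]])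
      then show ?thesis
        using True by (simp add: lie_bracket_def derivative_along_def field_scale_def algebra_simps)
    next
      case False
      then show ?thesis by (simp add: lie_bracket_def tangent_not_smooth[OF Xp])
    qed
  qed
  then have 2: "\<phi> p (lie_bracket M (field_scale f X) Y p) = f p * \<phi> p (lie_bracket M X Y p) + - Y p f * \<phi> p (X p)"
    using lie_bracket_field[OF X Y, THEN vector_fields_tangent, OF p] Xp
    by (simp only: linear_form_onD[OF lin] subspace_scale[OF subspace_tangent_space])
  show ?thesis
    unfolding exterior_derivative_def derivative_along_def 1 2 by (simp add: field_scale_def algebra_simps)
qed

lemma ed_sum:
  assumes "\<And>i. i \<in> I \<Longrightarrow> F i \<in> vector_fields M" and Y: "Y \<in> vector_fields M" and p: "p \<in> points M"
  shows "ed (\<Sum>i\<in>I. F i) Y p = (\<Sum>i\<in>I. ed (F i) Y p)"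
proof -
  have zero: "ed 0 Y p = 0"
    using ed_add[OF vector_fields_zero vector_fields_zero Y p] by simp
  show ?thesis
    using assms(1)
  proof (induction I rule: infinite_finite_induct)
    case (insert i I)
    then have F: "F i \<in> vector_fields M" "(\<Sum>i\<in>I. F i) \<in> vector_fields M"
      and IH: "ed (\<Sum>i\<in>I. F i) Y p = (\<Sum>i\<in>I. ed (F i) Y p)"
      by (simp_all add: vector_fields_sum)
    show ?case unfolding sum.insert[OF insert.hyps] ed_add[OF F Y p] IH ..
  qed (simp_all add: zero)
qed

text \<open>With \<open>q\<close> varying, \<open>frame_expansion\<close> becomes an identity of
  global fields with smooth coefficients, to which linearity over the smooth functions applies. Its
  value is that \<open>X\<close> enters the right-hand side through \<open>X p\<close>
  alone.\<close>

lemma ed_frame: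
  assumes "bump_chart M U c a r" and X: "X \<in> vector_fields M" and Y: "Y \<in> vector_fields M"
    and p: "p \<in> points M"
  defines "\<kappa> \<equiv> bump_chart.cutoff U c a r" and "u \<equiv> bump_chart.coordinate U c a r"
  shows "\<kappa> p ^ 3 * ed X Y p
    = (\<Sum>b\<in>Basis. (\<kappa> p * X p (u b) - u b p * X p \<kappa>) * ed (bump_chart.frame M U c a r b) Y p)"
proof -
  interpret bump_chart M U c a r by (rule assms(1))
  define k where "k b q = cutoff q * X q (coordinate b) - coordinate b q * X q cutoff" for b q
  have k: "smooth_function M (k b)" for b
    unfolding k_def
    by (intro smooth_function_diff smooth_function_mult smooth_cutoff smooth_coordinate vector_fields_smooth'[OF X])
  have c3: "smooth_function M (\<lambda>q. cutoff q * cutoff q * cutoff q)"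
    by (intro smooth_function_mult smooth_cutoff)
  have "field_scale (\<lambda>q. cutoff q * cutoff q * cutoff q) X = (\<Sum>b\<in>Basis. field_scale (k b) (frame b))"
  proof (intro ext)
    fix q f
    show "field_scale (\<lambda>q. cutoff q * cutoff q * cutoff q) X q f = (\<Sum>b\<in>Basis. field_scale (k b) (frame b)) q f"
    proof (cases "q \<in> points M")
      case True
      from frame_expansion[OF vector_fields_tangent[OF X True], of f] show ?thesis
        by (simp add: sum_field_apply field_scale_def k_def power3_eq_cube)
    next
      case False
      then show ?thesis
        by (simp add: sum_field_apply field_scale_def vector_fields_outside[OF X] vector_fields_outside[OF frame_vector_field])
    qed
  qed
  then have "cutoff p * cutoff p * cutoff p * ed X Y p = (\<Sum>b\<in>Basis. k b p * ed (frame b) Y p)"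
    using ed_scale[OF c3 X Y p]
    by (simp add: ed_sum[OF _ Y p] vector_fields_scale k frame_vector_field ed_scale[OF k frame_vector_field Y p])
  then show ?thesis unfolding \<kappa>_def u_def k_def by (simp add: power3_eq_cube)
qed

text \<open>In a chart centred at \<open>p\<close> the cutoff is nonzero at \<open>p\<close>, so
  \<open>ed_frame\<close> determines the value from \<open>X p\<close>. Antisymmetry moves the
  argument to the second slot.\<close>

lemma ed_tensorial:
  assumes X: "X \<in> vector_fields M" "X' \<in> vector_fields M" and Y: "Y \<in> vector_fields M" "Y' \<in> vector_fields M"
    and p: "p \<in> points M" and eq: "X p = X' p" "Y p = Y' p"
  shows "ed X Y p = ed X' Y' p"
proof -
  obtain U c r where bump: "bump_chart M U c (c p) r" and U: "p \<in> U"
    using p by (rule bump_chart_exists)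
  have c0: "bump_chart.cutoff U c (c p) r p ^ 3 \<noteq> 0"
    using bump_chart.cutoff_center[OF bump U refl] by simp
  have left: "ed X Y p = ed X' Y p"
    if "X \<in> vector_fields M" "X' \<in> vector_fields M" "Y \<in> vector_fields M" "X p = X' p" for X X' Y
  proof -
    have "bump_chart.cutoff U c (c p) r p ^ 3 * ed X Y p = bump_chart.cutoff U c (c p) r p ^ 3 * ed X' Y p"
      unfolding ed_frame[OF bump that(1,3) p] ed_frame[OF bump that(2,3) p] that(4) ..
    then show ?thesis using c0 by simp
  qed
  have "ed X Y p = ed X' Y p" using left X Y(1) eq(1) by blast
  also have "\<dots> = - ed Y X' p" using X(2) Y(1) p by (simp add: ed_antisym[of X' Y])
  also have "ed Y X' p = ed Y' X' p" using left Y X(2) eq(2) by blast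
  also have "- \<dots> = ed X' Y' p" using X(2) Y(2) p by (simp add: ed_antisym[of X' Y'])
  finally show ?thesis .
qed

section \<open>Vanishing of the exterior derivative\<close>

lemma ed_cyclic:
  assumes conj: "bianchi_identity_on (tangent_space M p) (conjugate_tensor (curvature_tensor M g D p))"
    and p: "p \<in> points M"
    and X: "X \<in> vector_fields M" and Y: "Y \<in> vector_fields M" and Z: "Z \<in> vector_fields M"
  shows "ed X Y p *\<^sub>R Z p + ed Y Z p *\<^sub>R X p + ed Z X p *\<^sub>R Y p = 0"
proof -
  let ?T = "tangent_space M p" and ?R = "curvature_tensor M g D p" and ?E = "extension_field M p"
  \<comment> \<open>\<open>curvature_tensor\<close> is evaluated on these very extensions, so the
    relations for fields apply to it directly. The passage to the given \<open>X\<close>,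
    \<open>Y\<close>, \<open>Z\<close> is made at the end, by \<open>ed_tensorial\<close>.\<close>
  define F where "F x y = ed (?E x) (?E y) p" for x y
  note ext = extension_field[OF p] and ext_apply = extension_field_apply[OF p]
  have R: "?R x y z w + ?R x y w z = 2 * (F x y * g p z w)"
    if "x \<in> ?T" "y \<in> ?T" "z \<in> ?T" "w \<in> ?T" for x y z w
  proof -
    have "curvature_operator M D (?E x) (?E y) (?E w) \<in> vector_fields M"
      unfolding curvature_operator_def using that
      by (intro vector_fields_diff connection_field lie_bracket_field ext)
    then have "g p (curvature_operator M D (?E x) (?E y) (?E w) p) z
        = g p z (curvature_operator M D (?E x) (?E y) (?E w) p)"
      using metric_inner[OF p] vector_fields_tangent[OF _ p] that(3) unfolding inner_product_on_def by blast
    with curvature_metric[OF ext[OF that(1)] ext[OF that(2)] ext[OF that(3)] ext[OF that(4)] p]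
    show ?thesis unfolding curvature_tensor_def F_def by (simp add: ext_apply that)
  qed
  have bianchi: "?R x y z w + ?R y z x w + ?R z x y w = 0"
    if "x \<in> ?T" "y \<in> ?T" "z \<in> ?T" "w \<in> ?T" for x y z w
  proof -
    have C: "curvature_operator M D (?E x) (?E y) (?E z) p \<in> ?T" if "x \<in> ?T" "y \<in> ?T" "z \<in> ?T" for x y z
    proof -
      have "curvature_operator M D (?E x) (?E y) (?E z) \<in> vector_fields M"
        unfolding curvature_operator_def using that
        by (intro vector_fields_diff connection_field lie_bracket_field ext)
      then show ?thesis using p by (rule vector_fields_tangent)
    qed
    have lin: "linear_form_on ?T (\<lambda>u. g p u w)" using metric_linear(1)[OF p that(4)] .
    have "?R x y z w + ?R y z x w + ?R z x y w
      = g p (curvature_operator M D (?E x) (?E y) (?E z) p + curvature_operator M D (?E y) (?E z) (?E x) p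
          + curvature_operator M D (?E z) (?E x) (?E y) p) w"
      unfolding curvature_tensor_def using that
      by (simp add: linear_form_onD(1)[OF lin] C subspace_add[OF subspace_tangent_space])
    \<comment> \<open>The zero vector is written as a multiple of \<open>w\<close> so that
      homogeneity of the form yields the value 0.\<close>
    also have "\<dots> = g p (0 *\<^sub>R w) w"
      by (simp add: curvature_bianchi[OF ext[OF that(1)] ext[OF that(2)] ext[OF that(3)] p])
    also have "\<dots> = 0" using linear_form_onD(2)[OF lin that(4), of 0] by simp
    finally show ?thesis .
  qed
  have T: "X p \<in> ?T" "Y p \<in> ?T" "Z p \<in> ?T" using X Y Z p by (simp_all add: vector_fields_tangent)
  have "F (X p) (Y p) *\<^sub>R Z p + F (Y p) (Z p) *\<^sub>R X p + F (Z p) (X p) *\<^sub>R Y p = 0"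
  proof (rule cyclic_sum_eq_0[OF subspace_tangent_space metric_inner[OF p] T])
    fix w assume w: "w \<in> ?T"
    have "- ?R (X p) (Y p) w (Z p) - ?R (Y p) (Z p) w (X p) - ?R (Z p) (X p) w (Y p) = 0"
      using conj T w unfolding bianchi_identity_on_def conjugate_tensor_def by fastforce
    with bianchi[OF T w] R[OF T w] R[OF T(2,3,1) w] R[OF T(3,1,2) w]
    show "F (X p) (Y p) * g p (Z p) w + F (Y p) (Z p) * g p (X p) w + F (Z p) (X p) * g p (Y p) w = 0"
      by linarith
  qed
  moreover have "F (A p) (B p) = ed A B p" if "A \<in> vector_fields M" "B \<in> vector_fields M" for A B
    unfolding F_def using vector_fields_tangent[OF that(1) p] vector_fields_tangent[OF that(2) p] that
    by (intro ed_tensorial ext p ext_apply)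
  ultimately show ?thesis using X Y Z by simp
qed

text \<open>For two distinct frame fields a third basis direction \<open>d\<close> exists.
  Evaluating the cyclic identity at \<open>p\<close> on \<open>coordinate d\<close> removes the two
  frame vectors in the other directions and leaves a nonzero multiple of the wanted value.
  \<open>ed_frame\<close> then extends the result from the frame to all fields.\<close>

lemma ed_eq_0:
  assumes conj: "bianchi_identity_on (tangent_space M p) (conjugate_tensor (curvature_tensor M g D p))"
    and p: "p \<in> points M" and dim: "DIM('e) \<ge> 3"
    and X: "X \<in> vector_fields M" and Y: "Y \<in> vector_fields M"
  shows "ed X Y p = 0"
proof -
  obtain U c r where bump: "bump_chart M U c (c p) r" and U: "p \<in> U"
    using p by (rule bump_chart_exists)
  interpret bump_chart M U c "c p" r by (rule bump)
  note frame = frame_vector_field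
  have c0: "cutoff p \<noteq> 0" using cutoff_center[OF U] by simp
  have basis: "ed (frame b) (frame b') p = 0" if b: "b \<in> Basis" "b' \<in> Basis" for b b'
  proof (cases "b = b'")
    case True
    then show ?thesis using ed_antisym[OF frame frame p, of b b] by simp
  next
    case False
    have "\<not> Basis \<subseteq> {b, b'}"
    proof
      assume "Basis \<subseteq> {b, b'}"
      then have "DIM('e) \<le> card {b, b'}" by (intro card_mono) auto
      with dim False show False by simp
    qed
    then obtain d where d: "d \<in> Basis" "d \<noteq> b" "d \<noteq> b'" by blast
    have coord: "frame i p (coordinate d) = (if i = d then (cutoff p)\<^sup>2 else 0)" if "i \<in> Basis" for i
      using frame_coordinate_center[OF U refl, of i d] that d(1) by (simp add: inner_Basis)
    have "(ed (frame b) (frame b') p *\<^sub>R frame d p + ed (frame b') (frame d) p *\<^sub>R frame b p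
        + ed (frame d) (frame b) p *\<^sub>R frame b' p) (coordinate d) = 0"
      by (simp only: ed_cyclic[OF conj p frame frame frame] zero_fun_apply)
    then show ?thesis using b d c0 by (simp add: coord)
  qed
  \<comment> \<open>\<open>ed_frame\<close> expands the first argument, so the second one is reached
    through antisymmetry.\<close>
  have "ed (frame b) Y p = 0" if b: "b \<in> Basis" for b
  proof -
    have "cutoff p ^ 3 * ed Y (frame b) p = 0"
      unfolding ed_frame[OF bump Y frame p] using basis[OF _ b] by simp
    then show ?thesis using c0 ed_antisym[OF Y frame p, of b] by simp
  qed
  then have "cutoff p ^ 3 * ed X Y p = 0" unfolding ed_frame[OF bump X Y p] by simp
  then show ?thesis using c0 by simp
qed

section \<open>From a closed Weyl form to a conformal metric\<close>

lemma form_exact: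
  assumes closed: "\<And>X Y p. X \<in> vector_fields M \<Longrightarrow> Y \<in> vector_fields M \<Longrightarrow> p \<in> points M \<Longrightarrow> ed X Y p = 0"
    and H1: "de_Rham_H1 M = {de_Rham_H1_zero M}"
  obtains f where "smooth_function M f" "\<And>p v. p \<in> points M \<Longrightarrow> v \<in> tangent_space M p \<Longrightarrow> \<phi> p v = v f"
proof -
  have \<phi>: "\<phi> \<in> closed_one_forms M"
    using one_form closed unfolding closed_one_forms_def by simp
  have "(\<lambda>p v. 0) \<in> one_forms M"
    unfolding one_forms_def linear_form_on_def using smooth_function_const[of 0] by simp
  then have "(\<lambda>p v. 0) \<in> exact_one_forms M"
    unfolding exact_one_forms_def using smooth_function_const[of 0] tangent_const[of _ _ 0]
    by (auto intro!: exI[of _ "\<lambda>q. 0"])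
  \<comment> \<open>As the zero form is exact, \<open>\<phi>\<close> lies in its own class, and by
    hypothesis the zero class is the only one.\<close>
  then have "(\<phi>, \<phi>) \<in> cohomologous M"
    unfolding cohomologous_def using \<phi> by simp
  moreover have "cohomologous M `` {\<phi>} \<in> de_Rham_H1 M"
    unfolding de_Rham_H1_def using \<phi> by (rule quotientI)
  ultimately have "\<phi> \<in> de_Rham_H1_zero M" unfolding H1 by auto
  \<comment> \<open>The zero class is the image of the zero form, which therefore comes first in the
    pair: the potential found is one of \<open>- \<phi>\<close>, and its sign is changed at the
    end.\<close>
  then have "(\<lambda>p v. 0 - \<phi> p v) \<in> exact_one_forms M"
    unfolding de_Rham_H1_zero_def cohomologous_def by simp
  then obtain f where f: "smooth_function M f" "\<And>p v. p \<in> points M \<Longrightarrow> v \<in> tangent_space M p \<Longrightarrow> 0 - \<phi> p v = v f"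
    unfolding exact_one_forms_def by auto
  show ?thesis
  proof
    show "smooth_function M (\<lambda>q. -1 * f q)" using f(1) by (rule smooth_function_cmult)
    show "\<phi> p v = v (\<lambda>q. -1 * f q)" if "p \<in> points M" "v \<in> tangent_space M p" for p v
      using f(2)[OF that] tangent_cmult[OF that(2) f(1), of "-1"] by simp
  qed
qed

text \<open>Differentiating the factor gives 2 df(X) e^(2f) g, which cancels the -2 phi(X) e^(2f) g
  of the Weyl equation; the 2 in the exponent matches the weight in that equation.\<close>

lemma levi_civita_conformal:
  assumes f: "smooth_function M f"
    and df: "\<And>p v. p \<in> points M \<Longrightarrow> v \<in> tangent_space M p \<Longrightarrow> \<phi> p v = v f"
  shows "levi_civita_connection M (\<lambda>p x y. exp (2 * f p) * g p x y) D"
proof -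
  let ?g = "\<lambda>p x y. exp (2 * f p) * g p x y"
  have f2: "smooth_function M (\<lambda>q. 2 * f q)" using f by (rule smooth_function_cmult)
  have exp: "smooth_on UNIV (exp :: real \<Rightarrow> real)" unfolding smooth_on_def by (simp add: Ck_on_exp)
  have e: "smooth_function M (\<lambda>q. exp (2 * f q))" using exp f2 by (rule smooth_function_compose)
  have exp': "frechet_derivative exp (at t) 1 = exp t" for t :: real
    using frechet_derivative_at[OF DERIV_exp[of t, unfolded has_field_derivative_def], THEN fun_cong, of 1]
    by simp
  have inner: "inner_product_on (tangent_space M p) (?g p)" if p: "p \<in> points M" for p
    using metric_inner[OF p]
    unfolding inner_product_on_def bilinear_form_on_def linear_form_on_def
    by (simp add: algebra_simps)
  have "pseudo_riemannian_metric M ?g"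
    unfolding pseudo_riemannian_metric_def using inner metric_smooth e
    by (simp add: smooth_function_mult)
  moreover have "covariant_derivative_metric D ?g X Y Z p = 0"
    if XYZ: "X \<in> vector_fields M" "Y \<in> vector_fields M" "Z \<in> vector_fields M" and p: "p \<in> points M" for X Y Z p
  proof -
    have v: "X p \<in> tangent_space M p" using XYZ(1) p by (rule vector_fields_tangent)
    have "X p (\<lambda>q. exp (2 * f q)) = exp (2 * f p) * (2 * X p f)"
      using tangent_compose[OF v exp f2] tangent_cmult[OF v f, of 2] by (simp only: exp')
    then show ?thesis
      using tangent_mult[OF v e metric_smooth[OF XYZ(2,3)]] derivative_metric[OF XYZ p] df[OF p v]
      unfolding covariant_derivative_metric_def derivative_along_def by (simp add: algebra_simps)
  qed
  ultimately show ?thesis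
    unfolding levi_civita_connection_def using affine torsion by simp
qed

end

theorem theorem4:
  fixes n :: nat
    and V :: "'v::real_vector set" and h :: "'v \<Rightarrow> 'v \<Rightarrow> real" and A :: "'v tensor4"
    and N :: "('a, 'e::euclidean_space) atlas_space"
    and g :: "'a metric_tensor" and D :: "'a connection"
  assumes "n \<ge> 3"
  shows "(subspace V \<and> dim V = n \<and> inner_product_on V h \<and> A \<in> weyl_curvature_tensors V h \<longrightarrow>
            (bianchi_identity_on V (conjugate_tensor A) \<longleftrightarrow> A \<in> algebraic_curvature_tensors V))
       \<and> (weyl_manifold N g D \<and> DIM('e) = n \<and> de_Rham_H1 N = {de_Rham_H1_zero N} \<and>
            (\<forall>p\<in>points N. conjugate_tensor (curvature_tensor N g D p)
                            \<in> generalized_curvature_tensors (tangent_space N p)) \<longrightarrow>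
            (\<exists>f. smooth_function N f \<and>
                 levi_civita_connection N (\<lambda>p x y. exp (2 * f p) * g p x y) D))"
proof (intro conjI impI; elim conjE)
  assume "subspace V" "dim V = n" "inner_product_on V h" "A \<in> weyl_curvature_tensors V h"
  then show "bianchi_identity_on V (conjugate_tensor A) \<longleftrightarrow> A \<in> algebraic_curvature_tensors V"
    using assms by (intro weyl_conjugate_bianchi_iff) simp_all
next
  assume W: "weyl_manifold N g D" and dim: "DIM('e) = n" and H1: "de_Rham_H1 N = {de_Rham_H1_zero N}"
    and R: "\<forall>p\<in>points N. conjugate_tensor (curvature_tensor N g D p)
      \<in> generalized_curvature_tensors (tangent_space N p)"
  from W obtain \<phi> where "\<phi> \<in> one_forms N"
    and "\<forall>X\<in>vector_fields N. \<forall>Y\<in>vector_fields N. \<forall>Z\<in>vector_fields N. \<forall>p\<in>points N.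
        covariant_derivative_metric D g X Y Z p = - 2 * \<phi> p (X p) * g p (Y p) (Z p)"
    unfolding weyl_manifold_def by (elim conjE bexE)
  then interpret weyl_structure N g D \<phi>
    using W unfolding weyl_manifold_def by unfold_locales simp_all
  have "ed X Y p = 0" if "X \<in> vector_fields N" "Y \<in> vector_fields N" "p \<in> points N" for X Y p
    using R that assms dim unfolding generalized_curvature_tensors_def by (intro ed_eq_0) simp_all
  then obtain f where "smooth_function N f" "\<And>p v. p \<in> points N \<Longrightarrow> v \<in> tangent_space N p \<Longrightarrow> \<phi> p v = v f"
    using H1 form_exact by blast
  then show "\<exists>f. smooth_function N f \<and> levi_civita_connection N (\<lambda>p x y. exp (2 * f p) * g p x y) D"
    using levi_civita_conformal by blast
qed

end
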